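(* Let $A$ be a closed symmetric relation in a Hilbert space $\mathcal H$ and let $\{\mathcal G,\Gamma_0,\Gamma_1\}$ be a quasi boundary triple for $A^*$ with $A_i=\ker\Gamma_i$, $i=0,1$, and Weyl function $M$. Assume that $A_1$ is self-adjoint and that the closure $\overline{M(\lambda_0)}$ is a compact operator in $\mathcal G$ (everywhere defined) for some $\lambda_0\in\mathbb C\setminus\mathbb R$. If $\Theta$ is a self-adjoint relation in $\mathcal G$ such that $$0\notin\sigma_{\rm ess}(\Theta)\qquad\text{and}\qquad \Theta^{-1}\bigl(\operatorname{ran}\overline{M(\lambda_\pm)}\bigr)\subset\mathcal G_0$$ hold for some $\lambda_+\in\mathbb C^+$ and some $\lambda_-\in\mathbb C^-$, then $A_\Theta=\{\hat f\in T:\Gamma\hat f\in\Theta\}$ is self-adjoint in $\mathcal H$. In particular, the second condition is satisfied if $\operatorname{dom}\Theta\subset\mathcal G_0$.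
   Context: Linear relations. A (closed) linear relation in a Hilbert space $\mathcal H$ is a (closed) linear subspace of $\mathcal H\times\mathcal H$; elements are written $\hat f=\binom{f}{f'}$, and operators are identified with their graphs. $\operatorname{dom}S=\{f:\exists f',\binom f{f'}\in S\}$, $\ker S=\{f:\binom f0\in S\}$, $\operatorname{mul}S=\{f':\binom0{f'}\in S\}$, $S-\lambda=\{\binom{f}{f'-\lambda f}:\binom f{f'}\in S\}$. For closed $S$, $\rho(S)$ is the set of $\lambda\in\mathbb C$ such that $(S-\lambda)^{-1}$ is a bounded everywhere defined operator. The adjoint is $S^*=\{\binom g{g'}:(f',g)=(f,g')\text{ for all }\binom f{f'}\in S\}$; $S$ is symmetric if $S\subset S^*$ and self-adjoint if $S=S^*$. A self-adjoint relation $S$ decomposes as $S=S_{\rm op}\oplus S_\infty$, where $S_{\rm op}$ is a self-adjoint operator in $\overline{\operatorname{dom}S}=(\operatorname{mul}S)^\perp$ and $S_\infty=\{\binom0{f'}:f'\in\operatorname{mul}S\}$; $\sigma_{\rm ess}(S):=\sigma_{\rm ess}(S_{\rm op})$, where the essential spectrum of a closed operator $R$ is the set of $\lambda$ such that $R-\lambda$ is not Fredholm. For a relation $\Theta$ in $\mathcal G$ and a subspace $X\subset\mathcal G$, $\Theta^{-1}(X)=\{x\in\mathcal G:\exists y\in X\text{ with }\binom xy\in\Theta\}$. $\mathbb C^\pm=\{z\in\mathbb C:\pm\operatorname{Im}z>0\}$. Quasi boundary triples. Let $A$ be a closed symmetric relation in $\mathcal H$. $\{\mathcal G,\Gamma_0,\Gamma_1\}$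 is a quasi boundary triple for $A^*$ if $\mathcal G$ is a Hilbert space and $\Gamma_0,\Gamma_1:T\to\mathcal G$ are linear mappings defined on a dense subspace $T$ of $A^*$ (dense in $A^*$ with respect to the topology of $\mathcal H\times\mathcal H$) such that $\Gamma=\binom{\Gamma_0}{\Gamma_1}:T\to\mathcal G\times\mathcal G$ has dense range, $\ker\Gamma_0$ is a self-adjoint relation in $\mathcal H$, and $(f',g)-(f,g')=(\Gamma_1\hat f,\Gamma_0\hat g)-(\Gamma_0\hat f,\Gamma_1\hat g)$ for all $\hat f=\binom f{f'},\hat g=\binom g{g'}\in T$. Weyl function. Let $A_0=\ker\Gamma_0$ and $\mathcal G_0=\operatorname{ran}\Gamma_0$ (dense in $\mathcal G$). For $\lambda\in\rho(A_0)$ let $\hat{\mathcal N}_{\lambda,T}=\{\binom{f}{\lambda f}: f\in\ker(T-\lambda)\}$; then $\Gamma_0$ restricted to $\hat{\mathcal N}_{\lambda,T}$ is a bijection onto $\mathcal G_0$, and $M(\lambda)=\Gamma_1(\Gamma_0\upharpoonright\hat{\mathcal N}_{\lambda,T})^{-1}:\mathcal G_0\to\mathcal G$ is regarded as a densely defined (closable) operator in $\mathcal G$; $\overline{M(\lambda)}$ denotes its closure. (If $M(\lambda_0)$ is bounded for one $\lambda_0\in\rho(A_0)$, then $M(\lambda)$ is bounded for all $\lambda\in\rho(A_0)$.) *)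

theory Defs
  imports "HOL-Analysis.Analysis"
begin

section \<open>Complex Hilbert spaces\<close>

text \<open>
  The inner product is linear in the first and antilinear in the second argument. Completeness
  comes from \<^class>\<open>banach\<close>; the zero space and non-separable spaces are allowed.
\<close>

class complex_hilbert_space = banach +
  fixes scaleC :: "complex \<Rightarrow> 'a \<Rightarrow> 'a"  (infixr "*\<^sub>C" 75)
    and cinner :: "'a \<Rightarrow> 'a \<Rightarrow> complex"
  assumes scaleC_add_right: "a *\<^sub>C (x + y) = a *\<^sub>C x + a *\<^sub>C y"
    and scaleC_add_left: "(a + b) *\<^sub>C x = a *\<^sub>C x + b *\<^sub>C x"
    and scaleC_scaleC: "a *\<^sub>C (b *\<^sub>C x) = (a * b) *\<^sub>C x"
    and scaleR_scaleC: "r *\<^sub>R x = complex_of_real r *\<^sub>C x"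
    and cinner_commute: "cinner x y = cnj (cinner y x)"
    and cinner_add_left: "cinner (x + y) z = cinner x z + cinner y z"
    and cinner_scaleC_left: "cinner (a *\<^sub>C x) y = a * cinner x y"
    and cinner_self: "cinner x x = complex_of_real ((norm x)\<^sup>2)"

instantiation complex :: complex_hilbert_space
begin

definition scaleC_complex :: "complex \<Rightarrow> complex \<Rightarrow> complex" where
  "scaleC_complex a x = a * x"

definition cinner_complex :: "complex \<Rightarrow> complex \<Rightarrow> complex" where
  "cinner_complex x y = x * cnj y"

instance
  by standard
    (simp_all add: scaleC_complex_def cinner_complex_def algebra_simps scaleR_conv_of_real
      complex_norm_square[symmetric])

end

instantiation prod :: (complex_hilbert_space, complex_hilbert_space) complex_hilbert_space
begin

definition scaleC_prod :: "complex \<Rightarrow> 'a \<times> 'b \<Rightarrow> 'a \<times> 'b" where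
  "scaleC_prod a x = (a *\<^sub>C fst x, a *\<^sub>C snd x)"

definition cinner_prod :: "'a \<times> 'b \<Rightarrow> 'a \<times> 'b \<Rightarrow> complex" where
  "cinner_prod x y = cinner (fst x) (fst y) + cinner (snd x) (snd y)"

instance
proof
  fix x y z :: "'a \<times> 'b" and a b :: complex and r :: real
  show "a *\<^sub>C (x + y) = a *\<^sub>C x + a *\<^sub>C y"
    by (simp add: scaleC_prod_def scaleC_add_right)
  show "(a + b) *\<^sub>C x = a *\<^sub>C x + b *\<^sub>C x"
    by (simp add: scaleC_prod_def scaleC_add_left)
  show "a *\<^sub>C (b *\<^sub>C x) = (a * b) *\<^sub>C x"
    by (simp add: scaleC_prod_def scaleC_scaleC)
  show "r *\<^sub>R x = complex_of_real r *\<^sub>C x"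
    by (simp add: scaleC_prod_def scaleR_prod_def scaleR_scaleC)
  show "cinner x y = cnj (cinner y x)"
    by (simp add: cinner_prod_def cinner_commute[of "fst x"] cinner_commute[of "snd x"])
  show "cinner (x + y) z = cinner x z + cinner y z"
    by (simp add: cinner_prod_def cinner_add_left)
  show "cinner (a *\<^sub>C x) y = a * cinner x y"
    by (simp add: cinner_prod_def scaleC_prod_def cinner_scaleC_left distrib_left)
  show "cinner x x = complex_of_real ((norm x)\<^sup>2)"
    by (simp add: cinner_prod_def cinner_self norm_prod_def)
qed

end

interpretation cvec: vector_space "scaleC :: complex \<Rightarrow> 'a \<Rightarrow> 'a::complex_hilbert_space"
proof
  fix x :: 'a
  show "1 *\<^sub>C x = x"
    using scaleR_scaleC[of 1 x] by simp
qed (simp_all add: scaleC_add_right scaleC_add_left scaleC_scaleC)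

text \<open>Complex-linear maps whose domain is the subspace \<open>T\<close>; values outside \<open>T\<close> are irrelevant.\<close>

definition clinear_on ::
    "'a::complex_hilbert_space set \<Rightarrow> ('a \<Rightarrow> 'b::complex_hilbert_space) \<Rightarrow> bool" where
  "clinear_on T f \<longleftrightarrow>
     (\<forall>x\<in>T. \<forall>y\<in>T. f (x + y) = f x + f y) \<and> (\<forall>c. \<forall>x\<in>T. f (c *\<^sub>C x) = c *\<^sub>C f x)"


section \<open>Linear relations\<close>

text \<open>
  Relations are sets of pairs; \<^const>\<open>Domain\<close>, \<^const>\<open>Range\<close>, \<^const>\<open>converse\<close> and relational image
  have their usual meaning, so \<open>\<Theta>\<inverse> `` X\<close> is the preimage of \<open>X\<close>. The adjoint is always closed and
  linear, hence \<open>self_adjoint S\<close> entails both for \<open>S\<close>.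
\<close>

definition linear_relation :: "('h::complex_hilbert_space \<times> 'h) set \<Rightarrow> bool" where
  "linear_relation S \<longleftrightarrow> cvec.subspace S"

definition ker_rel :: "('h::complex_hilbert_space \<times> 'h) set \<Rightarrow> 'h set" where
  "ker_rel S = {f. (f, 0) \<in> S}"

definition mul_rel :: "('h::complex_hilbert_space \<times> 'h) set \<Rightarrow> 'h set" where
  "mul_rel S = {f'. (0, f') \<in> S}"

definition shift_rel ::
    "('h::complex_hilbert_space \<times> 'h) set \<Rightarrow> complex \<Rightarrow> ('h \<times> 'h) set" where
  "shift_rel S \<mu> = {(f, f' - \<mu> *\<^sub>C f) | f f'. (f, f') \<in> S}"

definition adjoint_rel :: "('h::complex_hilbert_space \<times> 'h) set \<Rightarrow> ('h \<times> 'h) set" where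
  "adjoint_rel S = {(g, g'). \<forall>(f, f') \<in> S. cinner f' g = cinner f g'}"

definition symmetric_rel :: "('h::complex_hilbert_space \<times> 'h) set \<Rightarrow> bool" where
  "symmetric_rel S \<longleftrightarrow> S \<subseteq> adjoint_rel S"

definition self_adjoint :: "('h::complex_hilbert_space \<times> 'h) set \<Rightarrow> bool" where
  "self_adjoint S \<longleftrightarrow> S = adjoint_rel S"

text \<open>Graphs of everywhere defined compact operators.\<close>

definition compact_operator :: "('g::complex_hilbert_space \<times> 'g) set \<Rightarrow> bool" where
  "compact_operator K \<longleftrightarrow>
     linear_relation K \<and> mul_rel K = {0} \<and> Domain K = UNIV \<and> compact (closure (K `` cball 0 1))"


section \<open>Essential spectrum\<close>

text \<open>
  The operator \<open>R\<close> acts in the Hilbert space \<open>K\<close>, a closed subspace of the ambient space. Since the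
  range of \<open>R\<close> is a subspace of \<open>K\<close>, the last conjunct says that it has finite codimension in \<open>K\<close>.
\<close>

definition fredholm_in ::
    "'h::complex_hilbert_space set \<Rightarrow> ('h \<times> 'h) set \<Rightarrow> bool" where
  "fredholm_in K R \<longleftrightarrow>
     (\<exists>B. finite B \<and> cvec.span B = ker_rel R) \<and>
     closed (Range R) \<and>
     (\<exists>B. finite B \<and> cvec.span (Range R \<union> B) = K)"

definition ess_spectrum_in ::
    "'h::complex_hilbert_space set \<Rightarrow> ('h \<times> 'h) set \<Rightarrow> complex set" where
  "ess_spectrum_in K R = {\<mu>. \<not> fredholm_in K (shift_rel R \<mu>)}"

text \<open>
  For self-adjoint \<open>S\<close>, the closure of the domain is the orthogonal complement of the multivalued
  part, so the elements of \<open>S\<close> with both components in it form the operator part in the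
  decomposition \<open>S = S\<^sub>o\<^sub>p \<oplus> S\<^sub>\<infinity>\<close>.
\<close>

definition op_part :: "('h::complex_hilbert_space \<times> 'h) set \<Rightarrow> ('h \<times> 'h) set" where
  "op_part S = S \<inter> (closure (Domain S) \<times> closure (Domain S))"

definition ess_spectrum :: "('h::complex_hilbert_space \<times> 'h) set \<Rightarrow> complex set" where
  "ess_spectrum S = ess_spectrum_in (closure (Domain S)) (op_part S)"


section \<open>Quasi boundary triples\<close>

text \<open>
  The Hilbert space of the triple is the type \<open>'g\<close>; the common domain \<open>T\<close> of the boundary maps is
  an explicit parameter.
\<close>

definition quasi_boundary_triple ::
    "('h::complex_hilbert_space \<times> 'h) set \<Rightarrow> ('h \<times> 'h) set \<Rightarrow>
     ('h \<times> 'h \<Rightarrow> 'g::complex_hilbert_space) \<Rightarrow> ('h \<times> 'h \<Rightarrow> 'g) \<Rightarrow> bool" where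
  "quasi_boundary_triple A T \<Gamma>\<^sub>0 \<Gamma>\<^sub>1 \<longleftrightarrow>
     linear_relation T \<and> T \<subseteq> adjoint_rel A \<and> adjoint_rel A \<subseteq> closure T \<and>
     clinear_on T \<Gamma>\<^sub>0 \<and> clinear_on T \<Gamma>\<^sub>1 \<and>
     closure ((\<lambda>f. (\<Gamma>\<^sub>0 f, \<Gamma>\<^sub>1 f)) ` T) = UNIV \<and>
     self_adjoint {f \<in> T. \<Gamma>\<^sub>0 f = 0} \<and>
     (\<forall>(f, f') \<in> T. \<forall>(g, g') \<in> T.
        cinner f' g - cinner f g' =
        cinner (\<Gamma>\<^sub>1 (f, f')) (\<Gamma>\<^sub>0 (g, g')) - cinner (\<Gamma>\<^sub>0 (f, f')) (\<Gamma>\<^sub>1 (g, g')))"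

definition defect_rel ::
    "('h::complex_hilbert_space \<times> 'h) set \<Rightarrow> complex \<Rightarrow> ('h \<times> 'h) set" where
  "defect_rel T \<mu> = {(f, \<mu> *\<^sub>C f) | f. f \<in> ker_rel (shift_rel T \<mu>)}"

text \<open>
  The value of the Weyl function at \<open>\<mu>\<close>, as the graph of an operator with domain \<open>\<Gamma>\<^sub>0 ` T\<close>. It is
  meaningful for \<open>\<mu>\<close> in the resolvent set of \<open>ker \<Gamma>\<^sub>0\<close>, in particular for every non-real \<open>\<mu>\<close>, where
  \<open>\<Gamma>\<^sub>0\<close> maps \<open>defect_rel T \<mu>\<close> bijectively onto \<open>\<Gamma>\<^sub>0 ` T\<close>.
\<close>

definition weyl ::
    "('h::complex_hilbert_space \<times> 'h) set \<Rightarrow>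
     ('h \<times> 'h \<Rightarrow> 'g::complex_hilbert_space) \<Rightarrow> ('h \<times> 'h \<Rightarrow> 'g) \<Rightarrow>
     complex \<Rightarrow> ('g \<times> 'g) set" where
  "weyl T \<Gamma>\<^sub>0 \<Gamma>\<^sub>1 \<mu> = {(\<phi>, \<Gamma>\<^sub>1 (inv_into (defect_rel T \<mu>) \<Gamma>\<^sub>0 \<phi>)) | \<phi>. \<phi> \<in> \<Gamma>\<^sub>0 ` T}"

definition extension_rel ::
    "('h::complex_hilbert_space \<times> 'h) set \<Rightarrow>
     ('h \<times> 'h \<Rightarrow> 'g::complex_hilbert_space) \<Rightarrow> ('h \<times> 'h \<Rightarrow> 'g) \<Rightarrow>
     ('g \<times> 'g) set \<Rightarrow> ('h \<times> 'h) set" where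
  "extension_rel T \<Gamma>\<^sub>0 \<Gamma>\<^sub>1 \<Theta> = {f \<in> T. (\<Gamma>\<^sub>0 f, \<Gamma>\<^sub>1 f) \<in> \<Theta>}"

end

theory Submission
  imports Defs
begin

text \<open>
  By symmetry of \<open>A\<^sub>\<Theta>\<close> it suffices that \<open>A\<^sub>\<Theta> - \<mu>\<close> is surjective for \<open>\<mu> = \<mu>\<^sub>p, \<mu>\<^sub>m\<close>. Given \<open>h\<close>, choose
  \<open>f\<^sub>i \<in> A\<^sub>i\<close> with \<open>f\<^sub>i' - \<mu> f\<^sub>i = h\<close>. Their difference is a defect element, so \<open>\<Gamma>\<^sub>1 f\<^sub>0\<close> lies in the range
  of \<open>M(\<mu>)\<close>, and \<open>f\<^sub>0\<close> has to be corrected by the defect element with boundary value \<open>x\<close>, where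
  \<open>\<Gamma>\<^sub>1 f\<^sub>0 \<in> (\<Theta> - M(\<mu>)) x\<close>. Let \<open>N\<close> be the closure of \<open>M(\<mu>)\<close>, which is compact because \<open>M(\<mu>)\<close> is
  dominated by \<open>M(\<mu>\<^sub>0)\<close>, let \<open>F\<close> be the projection onto the finite-dimensional kernel of \<open>\<Theta>\<close>, and
  \<open>B = (\<Theta> + F)\<inverse>\<close>, which is everywhere defined and bounded. The equation becomes
  \<open>(I - B (N + F)) x = B \<Gamma>\<^sub>1 f\<^sub>0\<close>. The Fredholm alternative solves it: a kernel element satisfies
  \<open>(x, N x) \<in> \<Theta>\<close>, so \<open>x\<close> is in the range of \<open>\<Gamma>\<^sub>0\<close> by assumption and \<open>(M(\<mu>) x, x)\<close> is real, whence
  \<open>x = 0\<close>.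
\<close>

section \<open>Compact maps and the Fredholm alternative\<close>

text \<open>The sequential form lets sums, compositions and dominated maps be handled by passing to
  subsequences.\<close>

definition compact_map :: "('a::real_normed_vector \<Rightarrow> 'b::real_normed_vector) \<Rightarrow> bool" where
  "compact_map K \<longleftrightarrow>
     (\<forall>x :: nat \<Rightarrow> 'a. bounded (range x) \<longrightarrow> (\<exists>r l. strict_mono r \<and> (\<lambda>n. K (x (r n))) \<longlonglongrightarrow> l))"

lemma compact_mapD:
  assumes "compact_map K" "bounded (range (x :: nat \<Rightarrow> 'a::real_normed_vector))"
  obtains r l where "strict_mono r" "(\<lambda>n. K (x (r n))) \<longlonglongrightarrow> l"
  using assms unfolding compact_map_def by blast

lemma compact_map_compose:
  assumes "compact_map K" "\<And>l. isCont B l"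
  shows "compact_map (\<lambda>x. B (K x))"
  unfolding compact_map_def
proof (intro allI impI)
  fix x :: "nat \<Rightarrow> 'a" assume "bounded (range x)"
  with assms(1) obtain r l where "strict_mono r" "(\<lambda>n. K (x (r n))) \<longlonglongrightarrow> l"
    by (rule compact_mapD)
  then show "\<exists>r l. strict_mono r \<and> (\<lambda>n. B (K (x (r n)))) \<longlonglongrightarrow> l"
    using isCont_tendsto_compose[OF assms(2)] by blast
qed

lemma compact_map_add:
  assumes "compact_map K" "compact_map L"
  shows "compact_map (\<lambda>x. K x + L x)"
  unfolding compact_map_def
proof (intro allI impI)
  fix x :: "nat \<Rightarrow> 'a" assume x: "bounded (range x)"
  with assms(1) obtain r l where r: "strict_mono r" "(\<lambda>n. K (x (r n))) \<longlonglongrightarrow> l"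
    by (rule compact_mapD)
  have "bounded (range (x \<circ> r))"
    using x by (rule bounded_subset) auto
  with assms(2) obtain s k where s: "strict_mono s" "(\<lambda>n. L ((x \<circ> r) (s n))) \<longlonglongrightarrow> k"
    by (rule compact_mapD)
  have "(\<lambda>n. K (x (r (s n)))) \<longlonglongrightarrow> l"
    using LIMSEQ_subseq_LIMSEQ[OF r(2) s(1)] by (simp add: o_def)
  then have "(\<lambda>n. K (x ((r \<circ> s) n)) + L (x ((r \<circ> s) n))) \<longlonglongrightarrow> l + k"
    using s(2) by (auto intro: tendsto_add simp: o_def)
  moreover have "strict_mono (r \<circ> s)"
    using r s by (auto intro: strict_mono_o)
  ultimately show "\<exists>r l. strict_mono r \<and> (\<lambda>n. K (x (r n)) + L (x (r n))) \<longlonglongrightarrow> l"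
    by blast
qed

lemma compact_map_zero: "compact_map (\<lambda>x. 0)"
  unfolding compact_map_def using strict_mono_id by auto

lemma compact_map_sum:
  assumes "\<And>i. i \<in> I \<Longrightarrow> compact_map (K i)"
  shows "compact_map (\<lambda>x. \<Sum>i\<in>I. K i x)"
  using assms
  by (induction I rule: infinite_finite_induct) (auto intro: compact_map_zero compact_map_add)

lemma infdist_lessE:
  assumes "M \<noteq> {}" "infdist z M < c"
  obtains w where "w \<in> M" "dist z w < c"
  using assms by (auto simp: infdist_def cINF_less_iff)

text \<open>Riesz's argument: were \<open>S = I - K\<close> injective but not onto, the ranges of
  its powers would decrease strictly forever, and nearly orthogonal unit vectors in them would have
  images under \<open>K\<close> at mutual distance at least 1/2.\<close>

lemma Fredholm_alternative_surj:
  fixes K :: "'a::banach \<Rightarrow> 'a"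
  assumes K: "bounded_linear K"
    and cpt: "compact_map K"
    and ker: "\<And>x. K x = x \<Longrightarrow> x = 0"
  shows "\<exists>x. x - K x = y"
proof -
  interpret K: bounded_linear K by (rule K)
  define S where "S = (\<lambda>x. x - K x)"
  have S: "bounded_linear S"
    unfolding S_def by (intro bounded_linear_sub bounded_linear_ident K)
  interpret S: bounded_linear S by (rule S)
  have inj: "S x = S z \<longleftrightarrow> x = z" for x z
    using ker[of "x - z"] S.diff[of x z] by (auto simp: S_def K.diff algebra_simps)
  \<comment> \<open>Otherwise there are unit vectors with \<open>S (x n)\<close> tending to 0. Along
    a subsequence \<open>K (x n)\<close> converges, hence so does
    \<open>x n = S (x n) + K (x n)\<close>, to a unit vector in the kernel of
    \<open>S\<close>.\<close>
  have bdd: "\<exists>e>0. \<forall>x. e * norm x \<le> norm (S x)"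
  proof (rule ccontr)
    assume "\<not> ?thesis"
    then have "\<exists>x. norm (S x) < inverse (real (Suc n)) * norm x" for n
      by (meson not_le of_nat_0_less_iff positive_imp_inverse_positive zero_less_Suc)
    then obtain u where u: "\<And>n. norm (S (u n)) < inverse (real (Suc n)) * norm (u n)"
      by metis
    define x where "x n = u n /\<^sub>R norm (u n)" for n
    have u0: "u n \<noteq> 0" for n
      using u[of n] by auto
    then have x1: "norm (x n) = 1" for n
      by (simp add: x_def)
    have Sx: "norm (S (x n)) < inverse (real (Suc n))" for n
      using u[of n] u0[of n] by (simp add: x_def S.scaleR field_simps)
    have "bounded (range x)"
      using x1 by (auto simp: bounded_iff)
    with cpt obtain r l where r: "strict_mono r" and l: "(\<lambda>n. K (x (r n))) \<longlonglongrightarrow> l"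
      by (rule compact_mapD)
    have "(\<lambda>n. S (x n)) \<longlonglongrightarrow> 0"
      by (rule Lim_null_comparison[OF _ LIMSEQ_inverse_real_of_nat])
        (use Sx in \<open>auto intro: always_eventually less_imp_le\<close>)
    then have S0: "(\<lambda>n. S (x (r n))) \<longlonglongrightarrow> 0"
      using LIMSEQ_subseq_LIMSEQ[OF _ r] by (auto simp: o_def)
    have "(\<lambda>n. S (x (r n)) + K (x (r n))) \<longlonglongrightarrow> 0 + l"
      by (intro tendsto_add S0 l)
    then have xl: "(\<lambda>n. x (r n)) \<longlonglongrightarrow> l"
      by (simp add: S_def)
    from S.tendsto[OF xl] S0 have "S l = 0"
      using LIMSEQ_unique by blast
    then have "l = 0"
      using inj[of l 0] by (simp add: S.zero)
    moreover have "norm l = 1"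
      using tendsto_norm[OF xl] x1 by (simp add: LIMSEQ_const_iff)
    ultimately show False by simp
  qed
  then obtain e where e: "e > 0" "\<And>x. e * norm x \<le> norm (S x)" by blast
  define X where "X n = range (S ^^ n)" for n
  have X_Suc: "X (Suc n) = S ` X n" for n
    by (auto simp: X_def)
  have sub: "subspace (X n)" for n
  proof (induction n)
    case (Suc n)
    then show ?case
      unfolding X_Suc by (intro linear_subspace_image S.linear)
  qed (simp add: X_def subspace_UNIV)
  \<comment> \<open>A map bounded below sends complete subspaces to complete ones. Closedness is
    what makes the distance \<open>d\<close> below positive.\<close>
  have cl: "complete (X n)" for n
  proof (induction n)
    case (Suc n)
    then show ?case
      unfolding X_Suc
      by (intro complete_isometric_image[OF e(1) sub S]) (use e in auto)
  qed (simp add: X_def complete_UNIV)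
  have X_step: "X (Suc n) \<subseteq> X n" for n
  proof (induction n)
    case (Suc n)
    then show ?case
      unfolding X_Suc[of "Suc n"] unfolding X_Suc[of n] by (rule image_mono)
  qed (simp add: X_def)
  then have X_mono: "m \<le> n \<Longrightarrow> X n \<subseteq> X m" for m n
    using lift_Suc_antimono_le[of X] by blast
  show ?thesis
  proof (rule ccontr)
    assume "\<not> ?thesis"
    then have y: "S x \<noteq> y" for x
      by (auto simp: S_def)
    \<comment> \<open>Injectivity of \<open>S\<close> propagates the initial failure, that
      \<open>y\<close> is outside its range, to every power.\<close>
    have proper: "(S ^^ n) y \<notin> X (Suc n)" for n
    proof (induction n)
      case 0
      then show ?case using y by (auto simp: X_def)
    next
      case (Suc n)
      then show ?case
        unfolding X_Suc[of "Suc n"] by (auto simp: inj)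
    qed
    \<comment> \<open>Riesz's lemma, applied to each proper inclusion \<open>X (Suc n) \<subset> X n\<close>.\<close>
    have "\<exists>x. x \<in> X n \<and> norm x = 1 \<and> (\<forall>w\<in>X (Suc n). 1/2 \<le> norm (x - w))" for n
    proof -
      let ?z = "(S ^^ n) y" and ?Y = "X (Suc n)"
      define d where "d = infdist ?z ?Y"
      have ne: "?Y \<noteq> {}"
        by (auto simp: X_def)
      have "d \<noteq> 0"
        using in_closed_iff_infdist_zero[OF complete_imp_closed[OF cl[of "Suc n"]] ne] proper[of n]
        by (auto simp: d_def)
      then have d: "d > 0"
        using infdist_nonneg[of ?z ?Y] by (auto simp: d_def)
      \<comment> \<open>A point within twice the distance suffices: normalising divides
        \<open>d\<close> by less than \<open>2 * d\<close>, which gives the constant 1/2.\<close>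
      have "\<exists>w\<in>?Y. dist ?z w < 2 * d"
        using infdist_lessE[OF ne, of ?z "2 * d"] d by (auto simp: d_def)
      then obtain w where w: "w \<in> ?Y" "norm (?z - w) < 2 * d"
        by (auto simp: dist_norm)
      have pos: "norm (?z - w) > 0"
        using w proper by auto
      let ?x = "(?z - w) /\<^sub>R norm (?z - w)"
      have "?x \<in> X n"
        using w X_step[of n] by (intro subspace_scale subspace_diff sub) (auto simp: X_def)
      moreover have "1/2 \<le> norm (?x - v)" if "v \<in> ?Y" for v
      proof -
        have "d \<le> norm (?z - (w + norm (?z - w) *\<^sub>R v))"
          unfolding d_def dist_norm[symmetric]
          by (intro infdist_le subspace_add subspace_scale sub w that)
        also have "?z - (w + norm (?z - w) *\<^sub>R v) = norm (?z - w) *\<^sub>R (?x - v)"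
          using pos by (simp add: algebra_simps)
        finally have "d \<le> norm (?z - w) * norm (?x - v)"
          by simp
        also have "\<dots> \<le> 2 * d * norm (?x - v)"
          using w by (intro mult_right_mono) auto
        finally show ?thesis using d by simp
      qed
      ultimately show ?thesis
        using pos by (intro exI[of _ ?x]) auto
    qed
    then obtain x where x: "\<And>n. x n \<in> X n" "\<And>n. norm (x n) = 1"
      "\<And>n w. w \<in> X (Suc n) \<Longrightarrow> 1/2 \<le> norm (x n - w)"
      by metis
    \<comment> \<open>\<open>K (x n) - K (x m)\<close> equals \<open>x n\<close> minus
      \<open>S (x n) + x m - S (x m)\<close>, and for \<open>n < m\<close> the latter lies in
      \<open>X (Suc n)\<close>.\<close>
    have sep: "1/2 \<le> norm (K (x n) - K (x m))" if "n < m" for n m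
    proof -
      have "S (x n) + x m - S (x m) \<in> X (Suc n)"
        using x(1)[of n] x(1)[of m] X_mono[of "Suc n" m] X_mono[of "Suc n" "Suc m"] that X_Suc[of n] X_Suc[of m]
        by (intro subspace_add subspace_diff sub) auto
      from x(3)[OF this] show ?thesis
        by (simp add: S_def algebra_simps)
    qed
    have "bounded (range x)"
      using x by (auto simp: bounded_iff)
    with cpt obtain r l where r: "strict_mono r" and l: "(\<lambda>n. K (x (r n))) \<longlonglongrightarrow> l"
      by (rule compact_mapD)
    from LIMSEQ_imp_Cauchy[OF l] obtain N where
      "\<And>m n. m \<ge> N \<Longrightarrow> n \<ge> N \<Longrightarrow> norm (K (x (r m)) - K (x (r n))) < 1/2"
      by (metis (no_types, lifting) CauchyD half_gt_zero_iff zero_less_one)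
    from this[of N "Suc N"] sep[of "r N" "r (Suc N)"] r show False
      by (auto simp: strict_mono_def)
  qed
qed

text \<open>The uniform boundedness principle through Baire: the sublevel sets cover the space, so
  one contains a ball, and subtracting its centre moves the bound to the origin at the cost of a
  factor 2.\<close>

lemma seminorm_bounded_if_closed_sublevels:
  fixes N :: "'a::banach \<Rightarrow> real"
  assumes closed: "\<And>n::nat. closed {x. N x \<le> real n}"
    and sub: "\<And>x y. N (x - y) \<le> N x + N y"
    and scale: "\<And>r x. N (r *\<^sub>R x) = \<bar>r\<bar> * N x"
  shows "\<exists>C. \<forall>x. N x \<le> C * norm x"
proof -
  let ?C = "\<lambda>n::nat. {x. N x \<le> real n}"
  have "\<exists>n. interior (?C n) \<noteq> {}"
  proof (rule ccontr)
    assume "\<not> ?thesis"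
    then have "euclidean interior_of (\<Union>(range ?C)) = {}"
      using closed
      by (intro Baire_category_alt) (auto simp: completely_metrizable_space_euclidean)
    moreover have "\<Union>(range ?C) = UNIV"
      using real_arch_simple by auto
    ultimately show False by simp
  qed
  then obtain n x where "x \<in> interior (?C n)" by blast
  then obtain e where e: "e > 0" "cball x e \<subseteq> ?C n"
    by (auto simp: mem_interior_cball)
  have *: "N y \<le> (2 * real n / e) * norm y" for y
  proof (cases "y = 0")
    case True
    then show ?thesis using scale[of 0 y] by simp
  next
    case False
    let ?z = "(e / norm y) *\<^sub>R y"
    have "x + ?z \<in> ?C n" "x \<in> ?C n"
      using e False by (auto simp: subset_iff dist_norm)
    then have "N ?z \<le> 2 * real n"
      using sub[of "x + ?z" x] by simp
    then show ?thesis
      using False e by (simp add: scale field_simps)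
  qed
  then show ?thesis by blast
qed

section \<open>Geometry of complex Hilbert spaces\<close>

lemma cinner_scaleC_right: "cinner x (a *\<^sub>C y) = cnj a * cinner x y"
  by (metis cinner_commute cinner_scaleC_left complex_cnj_mult)

lemma cinner_add_right: "cinner x (y + z) = cinner x y + cinner x z"
  by (metis cinner_add_left cinner_commute complex_cnj_add)

lemma cinner_diff_left: "cinner (x - y) z = cinner x z - cinner y z"
  by (metis add_diff_cancel_right' cinner_add_left diff_add_cancel)

lemma cinner_diff_right: "cinner x (y - z) = cinner x y - cinner x z"
  by (metis add_diff_cancel_right' cinner_add_right diff_add_cancel)

lemma cinner_zero_left [simp]: "cinner 0 x = 0"
  using cinner_diff_left[of x x x] by simp

lemma cinner_zero_right [simp]: "cinner x 0 = 0"
  using cinner_diff_right[of x x x] by simp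

lemma cinner_minus_left: "cinner (- x) y = - cinner x y"
  using cinner_diff_left[of 0 x y] by simp

lemma cinner_sum_left: "cinner (\<Sum>i\<in>I. f i) y = (\<Sum>i\<in>I. cinner (f i) y)"
  by (induction I rule: infinite_finite_induct) (auto simp: cinner_add_left)

lemma cinner_sum_right: "cinner x (\<Sum>i\<in>I. f i) = (\<Sum>i\<in>I. cinner x (f i))"
  by (induction I rule: infinite_finite_induct) (auto simp: cinner_add_right)

lemma norm_sq_cinner: "(norm x)\<^sup>2 = Re (cinner x x)"
  by (simp add: cinner_self)

lemma mult_cnj_cmod: "a * cnj a = (complex_of_real (cmod a))\<^sup>2"
  by (simp only: of_real_power[symmetric] complex_norm_square)

lemma norm_scaleC [simp]: "norm (a *\<^sub>C x) = cmod a * norm x"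
proof -
  have "complex_of_real ((norm (a *\<^sub>C x))\<^sup>2) = complex_of_real ((cmod a * norm x)\<^sup>2)"
    unfolding cinner_self[symmetric] cinner_scaleC_left cinner_scaleC_right
    unfolding cinner_self of_real_power of_real_mult power_mult_distrib
    by (simp add: mult_cnj_cmod[symmetric] mult_ac)
  then have "(norm (a *\<^sub>C x))\<^sup>2 = (cmod a * norm x)\<^sup>2"
    by (simp only: of_real_eq_iff)
  then show ?thesis
    by (rule power2_eq_imp_eq) auto
qed

text \<open>Pythagoras for the component of \<open>w\<close> orthogonal to \<open>x\<close>. It
  yields Cauchy-Schwarz and, later, the orthogonality of a distance minimiser.\<close>

lemma norm_sq_diff_projection:
  assumes "x \<noteq> 0"
  shows "(norm (w - (cinner w x / (norm x)\<^sup>2) *\<^sub>C x))\<^sup>2 = (norm w)\<^sup>2 - (cmod (cinner w x))\<^sup>2 / (norm x)\<^sup>2"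
proof -
  define a where "a = cinner w x"
  have xw: "cinner x w = cnj a"
    unfolding a_def by (rule cinner_commute)
  have "complex_of_real ((norm (w - (a / (norm x)\<^sup>2) *\<^sub>C x))\<^sup>2)
      = (norm w)\<^sup>2 - a * cnj a / (norm x)\<^sup>2"
    unfolding cinner_self[symmetric] cinner_diff_left cinner_diff_right cinner_scaleC_left
      cinner_scaleC_right xw a_def[symmetric]
    unfolding cinner_self using assms
    by (simp add: field_simps power2_eq_square)
  also have "\<dots> = complex_of_real ((norm w)\<^sup>2 - (cmod a)\<^sup>2 / (norm x)\<^sup>2)"
    by (simp add: mult_cnj_cmod)
  finally show ?thesis
    unfolding a_def by (simp only: of_real_eq_iff)
qed

lemma cinner_Cauchy_Schwarz: "cmod (cinner x y) \<le> norm x * norm y"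
proof (cases "y = 0")
  case False
  then have "(cmod (cinner x y))\<^sup>2 / (norm y)\<^sup>2 \<le> (norm x)\<^sup>2"
    using norm_sq_diff_projection[OF False, of x] zero_le_power2
    by (metis diff_ge_0_iff_ge)
  then have "(cmod (cinner x y))\<^sup>2 \<le> (norm x * norm y)\<^sup>2"
    using False by (simp add: field_simps)
  then show ?thesis
    by (rule power2_le_imp_le) simp
qed simp

section \<open>Continuity of the operations and closures of complex subspaces\<close>

lemma bounded_bilinear_cinner:
  "bounded_bilinear (cinner :: 'a::complex_hilbert_space \<Rightarrow> 'a \<Rightarrow> complex)"
  by standard
    (auto simp: cinner_add_left cinner_add_right scaleR_scaleC cinner_scaleC_left scaleC_complex_def
      cinner_scaleC_right intro!: exI[of _ 1] cinner_Cauchy_Schwarz)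

lemma bounded_bilinear_scaleC:
  "bounded_bilinear ((*\<^sub>C) :: complex \<Rightarrow> 'a::complex_hilbert_space \<Rightarrow> 'a)"
  by standard
    (auto simp: scaleC_add_left scaleC_add_right scaleR_scaleC scaleC_scaleC scaleC_complex_def
      mult.commute intro!: exI[of _ 1])

lemma fst_scaleC: "fst (a *\<^sub>C p) = a *\<^sub>C fst p"
  and snd_scaleC: "snd (a *\<^sub>C p) = a *\<^sub>C snd p"
  by (simp_all add: scaleC_prod_def)

lemmas tendsto_scaleC = bounded_bilinear.tendsto[OF bounded_bilinear_scaleC]
lemmas continuous_on_cinner [continuous_intros] =
  bounded_bilinear.continuous_on[OF bounded_bilinear_cinner]

lemma csubspace_imp_subspace: "cvec.subspace M \<Longrightarrow> subspace M"
  by (auto simp: subspace_def cvec.subspace_def scaleR_scaleC)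

lemma csubspace_closure:
  assumes "cvec.subspace (M :: 'a::complex_hilbert_space set)"
  shows "cvec.subspace (closure M)"
  unfolding cvec.subspace_def
proof (intro conjI ballI allI)
  show "0 \<in> closure M"
    using assms closure_subset by (auto simp: cvec.subspace_def)
next
  fix x y assume "x \<in> closure M" "y \<in> closure M"
  then obtain f g where "\<And>n. f n \<in> M" "f \<longlonglongrightarrow> x" "\<And>n. g n \<in> M" "g \<longlonglongrightarrow> y"
    by (meson closure_sequential)
  then show "x + y \<in> closure M"
    using assms unfolding closure_sequential
    by (intro exI[of _ "\<lambda>n. f n + g n"]) (auto intro: tendsto_add simp: cvec.subspace_def)
next
  fix c x assume "x \<in> closure M"
  then obtain f where "\<And>n. f n \<in> M" "f \<longlonglongrightarrow> x"
    by (meson closure_sequential)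
  then show "c *\<^sub>C x \<in> closure M"
    using assms unfolding closure_sequential
    by (intro exI[of _ "\<lambda>n. c *\<^sub>C f n"])
      (auto intro: tendsto_scaleC tendsto_const simp: cvec.subspace_def)
qed

section \<open>Orthogonal projection and finite orthonormal bases\<close>

lemma parallelogram:
  "(norm (x + y))\<^sup>2 + (norm (x - y))\<^sup>2 = 2 * (norm x)\<^sup>2 + 2 * (norm (y::'a::complex_hilbert_space))\<^sup>2"
  by (simp add: norm_sq_cinner cinner_add_left cinner_add_right cinner_diff_left cinner_diff_right)

text \<open>A minimising sequence for the distance to \<open>M\<close> is Cauchy by the
  parallelogram law. Its limit is the projection, since any component of \<open>z - m\<close> along
  \<open>M\<close> could be removed to shorten it.\<close>

lemma orthogonal_decomposition:
  fixes M :: "'a::complex_hilbert_space set"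
  assumes M: "cvec.subspace M" "closed M"
  obtains m where "m \<in> M" "\<And>x. x \<in> M \<Longrightarrow> cinner (z - m) x = 0"
proof -
  define d where "d = infdist z M"
  have sM: "subspace M"
    using M(1) by (rule csubspace_imp_subspace)
  then have ne: "M \<noteq> {}"
    using subspace_0 by auto
  have d_le: "d \<le> norm (z - w)" if "w \<in> M" for w
    using infdist_le[OF that, of z] by (simp add: d_def dist_norm)
  have d0: "d \<ge> 0"
    by (simp add: d_def infdist_nonneg)
  have "\<exists>w\<in>M. norm (z - w) < d + inverse (real (Suc n))" for n
    using infdist_lessE[OF ne, of z "d + inverse (real (Suc n))"] by (auto simp: d_def dist_norm)
  then obtain w where w: "\<And>n. w n \<in> M" "\<And>n. norm (z - w n) < d + inverse (real (Suc n))"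
    by metis
  have lim: "(\<lambda>n. norm (z - w n)) \<longlonglongrightarrow> d"
  proof (rule tendsto_sandwich)
    show "\<forall>\<^sub>F n in sequentially. d \<le> norm (z - w n)"
      by (intro always_eventually allI d_le w(1))
    show "\<forall>\<^sub>F n in sequentially. norm (z - w n) \<le> d + inverse (real (Suc n))"
      by (intro always_eventually allI less_imp_le[OF w(2)])
    show "(\<lambda>n. d + inverse (real (Suc n))) \<longlonglongrightarrow> d"
      using tendsto_add[OF tendsto_const[of d] LIMSEQ_inverse_real_of_nat] by simp
    show "(\<lambda>n. d) \<longlonglongrightarrow> d" by simp
  qed
  \<comment> \<open>The midpoint of \<open>w i\<close> and \<open>w j\<close> lies in
    \<open>M\<close>, so its distance from \<open>z\<close> is at least \<open>d\<close>; this
    bounds the sum term of the parallelogram law from below.\<close>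
  have est: "(norm (w i - w j))\<^sup>2 \<le> 2 * ((norm (z - w i))\<^sup>2 - d\<^sup>2) + 2 * ((norm (z - w j))\<^sup>2 - d\<^sup>2)" for i j
  proof -
    have "(1/2) *\<^sub>R (w i + w j) \<in> M"
      using w by (intro subspace_scale subspace_add sM)
    then have "d \<le> norm (z - (1/2) *\<^sub>R (w i + w j))" by (rule d_le)
    then have "d\<^sup>2 \<le> (norm (z - (1/2) *\<^sub>R (w i + w j)))\<^sup>2"
      using d0 by (intro power_mono)
    moreover have "(z - w i) + (z - w j) = 2 *\<^sub>R (z - (1/2) *\<^sub>R (w i + w j))"
      by (simp add: algebra_simps scaleR_2)
    then have "(norm ((z - w i) + (z - w j)))\<^sup>2 = 4 * (norm (z - (1/2) *\<^sub>R (w i + w j)))\<^sup>2"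
      by (simp add: power_mult_distrib)
    moreover have "norm ((z - w i) - (z - w j)) = norm (w i - w j)"
      by (simp add: norm_minus_commute)
    ultimately show ?thesis
      using parallelogram[of "z - w i" "z - w j"] by simp
  qed
  have lim0: "(\<lambda>n. (norm (z - w n))\<^sup>2 - d\<^sup>2) \<longlonglongrightarrow> 0"
    using tendsto_diff[OF tendsto_power[OF lim, of 2] tendsto_const[of "d\<^sup>2"]] by simp
  have "Cauchy w"
  proof (rule CauchyI)
    fix e :: real assume e: "e > 0"
    then have "e\<^sup>2 / 4 > 0" by simp
    from order_tendstoD(2)[OF lim0 this] obtain N
      where N: "\<And>n. n \<ge> N \<Longrightarrow> (norm (z - w n))\<^sup>2 - d\<^sup>2 < e\<^sup>2 / 4"
      by (auto simp: eventually_sequentially)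
    have "norm (w i - w j) < e" if "i \<ge> N" "j \<ge> N" for i j
    proof (rule power2_less_imp_less)
      show "(norm (w i - w j))\<^sup>2 < e\<^sup>2"
        using est[of i j] N[OF that(1)] N[OF that(2)] by simp
    qed (use e in auto)
    then show "\<exists>M. \<forall>m\<ge>M. \<forall>n\<ge>M. norm (w m - w n) < e" by blast
  qed
  then obtain m where m: "w \<longlonglongrightarrow> m"
    using Cauchy_convergent_iff convergent_def by blast
  have mM: "m \<in> M"
    using M(2) w(1) m closed_sequentially by blast
  have "(\<lambda>n. norm (z - w n)) \<longlonglongrightarrow> norm (z - m)"
    by (intro tendsto_intros m)
  then have nd: "norm (z - m) = d"
    using lim LIMSEQ_unique by blast
  have "cinner (z - m) x = 0" if x: "x \<in> M" for x
  proof (cases "x = 0")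
    case False
    \<comment> \<open>This is the coefficient of the projection of \<open>z - m\<close> onto
      \<open>x\<close>; the shift by it would reduce the squared distance by the Pythagorean
      term.\<close>
    let ?c = "cinner (z - m) x / (norm x)\<^sup>2"
    have "m + ?c *\<^sub>C x \<in> M"
      using M(1) mM x unfolding cvec.subspace_def by blast
    from d_le[OF this] have "d\<^sup>2 \<le> (norm (z - m - ?c *\<^sub>C x))\<^sup>2"
      using d0 by (auto intro!: power_mono simp: algebra_simps)
    then have "(cmod (cinner (z - m) x))\<^sup>2 / (norm x)\<^sup>2 \<le> 0"
      unfolding norm_sq_diff_projection[OF False] nd by simp
    then show ?thesis
      using False by (simp add: divide_le_0_iff)
  qed simp
  with mM show ?thesis by (rule that)
qed

text \<open>Gram-Schmidt, by induction on \<open>B\<close>; a new vector already in the span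
  (\<open>b = p\<close>) leaves the orthonormal set unchanged.\<close>

lemma orthonormal_basis_finite_span:
  fixes B :: "'a::complex_hilbert_space set"
  assumes "finite B"
  obtains E where "finite E" "cvec.span E = cvec.span B"
    "\<And>x y. x \<in> E \<Longrightarrow> y \<in> E \<Longrightarrow> cinner x y = (if x = y then 1 else 0)"
proof -
  have "\<exists>E. finite E \<and> cvec.span E = cvec.span B
      \<and> (\<forall>x\<in>E. \<forall>y\<in>E. cinner x y = (if x = y then 1 else 0))"
    using assms
  proof (induction B)
    case empty
    then show ?case by (intro exI[of _ "{}"]) auto
  next
    case (insert b B)
    then obtain E where E: "finite E" "cvec.span E = cvec.span B"
      and on: "\<And>x y. x \<in> E \<Longrightarrow> y \<in> E \<Longrightarrow> cinner x y = (if x = y then 1 else 0)"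
      by blast
    define p where "p = (\<Sum>e\<in>E. cinner b e *\<^sub>C e)"
    have p: "p \<in> cvec.span E"
      unfolding p_def by (intro cvec.span_sum cvec.span_scale cvec.span_base)
    have orth: "cinner (b - p) e = 0" if "e \<in> E" for e
    proof -
      have "cinner p e = (\<Sum>x\<in>E. if x = e then cinner b e else 0)"
        unfolding p_def cinner_sum_left cinner_scaleC_left
        using that by (intro sum.cong) (auto simp: on)
      then show ?thesis
        using that E by (simp add: cinner_diff_left)
    qed
    show ?case
    proof (cases "b = p")
      case True
      then have "cvec.span (insert b B) = cvec.span B"
        using p E cvec.span_redundant by simp
      then show ?thesis using E on by blast
    next
      case False
      define n where "n = complex_of_real (norm (b - p))"
      have n: "n \<noteq> 0" "n * cnj n = cinner (b - p) (b - p)" "cnj n = n"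
        using False by (auto simp: n_def cinner_self power2_eq_square)
      define e where "e = inverse n *\<^sub>C (b - p)"
      have e1: "cinner e e = 1"
        using n unfolding e_def cinner_scaleC_left cinner_scaleC_right
        by (simp add: n(2)[symmetric] field_simps)
      have e0: "cinner e x = 0" "cinner x e = 0" if "x \<in> E" for x
        using orth[OF that] cinner_commute[of x e] unfolding e_def cinner_scaleC_left by auto
      have sE: "cvec.span E \<subseteq> cvec.span (insert e E)" "cvec.span B \<subseteq> cvec.span (insert b B)"
        by (intro cvec.span_mono subset_insertI)+
      have "b = n *\<^sub>C e + p"
        using n by (simp add: e_def)
      also have "\<dots> \<in> cvec.span (insert e E)"
        using p sE by (blast intro: cvec.span_add cvec.span_scale cvec.span_base)
      finally have b: "b \<in> cvec.span (insert e E)" .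
      have "e \<in> cvec.span (insert b B)"
        unfolding e_def using p sE E by (blast intro: cvec.span_scale cvec.span_diff cvec.span_base)
      moreover have "E \<subseteq> cvec.span (insert b B)"
        using sE E cvec.span_superset by blast
      ultimately have "cvec.span (insert e E) \<subseteq> cvec.span (insert b B)"
        by (intro cvec.span_minimal cvec.subspace_span) auto
      moreover have "B \<subseteq> cvec.span (insert e E)"
        using sE E cvec.span_superset by blast
      with b have "cvec.span (insert b B) \<subseteq> cvec.span (insert e E)"
        by (intro cvec.span_minimal cvec.subspace_span) auto
      moreover have "e \<notin> E"
        using e1 e0[of e] by auto
      ultimately show ?thesis
        using E e1 e0 on by (intro exI[of _ "insert e E"]) auto
    qed
  qed
  then show ?thesis using that by blast
qed

text \<open>Symmetry alone gives linearity, and it writes \<open>norm (B x)\<close> as a supremum of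
  the continuous functions \<open>cmod (cinner x (B y))\<close> over the unit ball. Sublevel sets
  are therefore closed and uniform boundedness applies.\<close>

lemma Hellinger_Toeplitz:
  fixes B :: "'a::complex_hilbert_space \<Rightarrow> 'a"
  assumes sym: "\<And>x y. cinner (B x) y = cinner x (B y)"
  shows "bounded_linear B"
proof -
  have eqI: "u = v" if "\<And>y. cinner u y = cinner v y" for u v :: 'a
    using that[of "u - v"] cinner_diff_left[of u v "u - v"] by (simp add: cinner_self)
  have add: "B (x + y) = B x + B y" for x y
    by (rule eqI) (simp add: sym cinner_add_left)
  have scale: "B (r *\<^sub>R x) = r *\<^sub>R B x" for r x
    by (rule eqI) (simp add: sym cinner_scaleC_left scaleR_scaleC)
  have lin: "linear B"
    by (intro linearI add scale)
  have closed_eq: "{x. norm (B x) \<le> real n} = (\<Inter>y\<in>cball 0 1. {x. cmod (cinner x (B y)) \<le> real n})" for n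
  proof (intro set_eqI iffI)
    fix x assume "x \<in> {x. norm (B x) \<le> real n}"
    then have "cmod (cinner x (B y)) \<le> real n" if "norm y \<le> 1" for y
      using that mult_left_le[of "norm y" "norm (B x)"] cinner_Cauchy_Schwarz[of "B x" y]
      by (simp add: sym[symmetric])
    then show "x \<in> (\<Inter>y\<in>cball 0 1. {x. cmod (cinner x (B y)) \<le> real n})" by auto
  next
    fix x assume *: "x \<in> (\<Inter>y\<in>cball 0 1. {x. cmod (cinner x (B y)) \<le> real n})"
    show "x \<in> {x. norm (B x) \<le> real n}"
    proof (cases "B x = 0")
      case False
      \<comment> \<open>The normalised \<open>B x\<close> attains the supremum.\<close>
      let ?y = "inverse (norm (B x)) *\<^sub>R B x"
      have "?y \<in> cball 0 1"
        using False by simp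
      with * have "cmod (cinner (B x) ?y) \<le> real n"
        by (auto simp: sym)
      moreover have "cinner (B x) ?y = norm (B x)"
        using False by (simp add: scaleR_scaleC cinner_scaleC_right cinner_self power2_eq_square)
      ultimately show ?thesis by simp
    qed simp
  qed
  have "closed {x. norm (B x) \<le> real n}" for n
    unfolding closed_eq by (intro closed_INT ballI closed_Collect_le continuous_intros)
  then have "\<exists>C. \<forall>x. norm (B x) \<le> C * norm x"
    by (rule seminorm_bounded_if_closed_sublevels)
      (auto simp: linear_diff[OF lin] scale norm_triangle_ineq4)
  then obtain C where "\<And>x. norm (B x) \<le> norm x * C"
    by (auto simp: mult.commute)
  then show ?thesis
    using add scale by (rule bounded_linear_intro[rotated 2])
qed

section \<open>Self-adjoint relations\<close>

lemma adjoint_rel_iff: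
  "(g, g') \<in> adjoint_rel S \<longleftrightarrow> (\<forall>f f'. (f, f') \<in> S \<longrightarrow> cinner f' g = cinner f g')"
  by (auto simp: adjoint_rel_def)

lemma self_adjointD:
  assumes "self_adjoint S" "(f, f') \<in> S" "(g, g') \<in> S"
  shows "cinner f' g = cinner f g'"
  using assms adjoint_rel_iff[of g g' S] by (simp add: self_adjoint_def)

lemma self_adjointI:
  assumes "self_adjoint S" "\<And>f f'. (f, f') \<in> S \<Longrightarrow> cinner f' g = cinner f g'"
  shows "(g, g') \<in> S"
  using assms adjoint_rel_iff[of g g' S] by (simp add: self_adjoint_def)

lemma csubspace_adjoint_rel: "cvec.subspace (adjoint_rel S)"
  unfolding cvec.subspace_def
  by (auto simp: adjoint_rel_iff zero_prod_def scaleC_prod_def cinner_add_right cinner_scaleC_right)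

lemma closed_adjoint_rel: "closed (adjoint_rel S)"
proof -
  have "adjoint_rel S = (\<Inter>p\<in>S. {q. cinner (snd p) (fst q) = cinner (fst p) (snd q)})"
    by (fastforce simp: adjoint_rel_def)
  also have "closed \<dots>"
    by (intro closed_INT ballI closed_Collect_eq continuous_intros)
  finally show ?thesis .
qed

lemma self_adjoint_csubspace: "self_adjoint S \<Longrightarrow> cvec.subspace S"
  using csubspace_adjoint_rel[of S] by (simp add: self_adjoint_def)

lemma self_adjoint_closed: "self_adjoint S \<Longrightarrow> closed S"
  using closed_adjoint_rel[of S] by (simp add: self_adjoint_def)

lemma rel_add: "cvec.subspace S \<Longrightarrow> (f, f') \<in> S \<Longrightarrow> (g, g') \<in> S \<Longrightarrow> (f + g, f' + g') \<in> S"
  using cvec.subspace_add[of S "(f, f')" "(g, g')"] by simp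

lemma rel_diff: "cvec.subspace S \<Longrightarrow> (f, f') \<in> S \<Longrightarrow> (g, g') \<in> S \<Longrightarrow> (f - g, f' - g') \<in> S"
  using cvec.subspace_diff[of S "(f, f')" "(g, g')"] by simp

lemma rel_scale: "cvec.subspace S \<Longrightarrow> (f, f') \<in> S \<Longrightarrow> (a *\<^sub>C f, a *\<^sub>C f') \<in> S"
  using cvec.subspace_scale[of S "(f, f')" a] by (simp add: scaleC_prod_def)

lemma rel_zero: "cvec.subspace S \<Longrightarrow> (0, 0) \<in> S"
  using cvec.subspace_0[of S] by (simp add: zero_prod_def)

lemmas rel_intros = rel_add rel_diff rel_scale rel_zero

text \<open>Since \<open>cinner f' f\<close> is real, pairing \<open>f' - \<mu> f\<close> with
  \<open>f\<close> leaves only \<open>\<mu>\<close> to contribute to the imaginary part.\<close>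

lemma symmetric_shift_bound:
  assumes "cinner f' f = cinner f f'"
  shows "\<bar>Im \<mu>\<bar> * norm f \<le> norm (f' - \<mu> *\<^sub>C f)"
proof (cases "f = 0")
  case False
  have "Im (cinner f' f) = 0"
    using assms cinner_commute[of f f'] by (simp add: complex_eq_iff)
  then have "Im (cinner (f' - \<mu> *\<^sub>C f) f) = - Im \<mu> * (norm f)\<^sup>2"
    by (simp add: cinner_diff_left cinner_scaleC_left cinner_self flip: of_real_power)
  then have "\<bar>Im \<mu>\<bar> * (norm f)\<^sup>2 = \<bar>Im (cinner (f' - \<mu> *\<^sub>C f) f)\<bar>"
    by (simp add: abs_mult)
  also have "\<dots> \<le> norm (f' - \<mu> *\<^sub>C f) * norm f"
    using abs_Im_le_cmod cinner_Cauchy_Schwarz order_trans by blast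
  finally show ?thesis
    using False by (simp add: power2_eq_square mult.assoc[symmetric])
qed simp

text \<open>The lower bound makes the range of the shift closed. A vector orthogonal to it is an
  eigenvector of the adjoint, hence of \<open>S\<close>, for the non-real number
  \<open>cnj \<mu>\<close>, so it vanishes.\<close>

lemma self_adjoint_range_shift:
  fixes h :: "'a::complex_hilbert_space"
  assumes S: "self_adjoint S" and \<mu>: "Im \<mu> \<noteq> 0"
  obtains p where "p \<in> S" "snd p - \<mu> *\<^sub>C fst p = h"
proof -
  define L :: "'a \<times> 'a \<Rightarrow> 'a" where "L p = snd p - \<mu> *\<^sub>C fst p" for p
  note sub = self_adjoint_csubspace[OF S]
  have L: "bounded_linear L"
    unfolding L_def
    by (intro bounded_linear_sub bounded_linear_snd bounded_linear_fst
      bounded_linear_compose[OF bounded_bilinear.bounded_linear_right[OF bounded_bilinear_scaleC]])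
  \<comment> \<open>The constant collects
    \<open>norm f \<le> norm (L p) / \<bar>Im \<mu>\<bar>\<close> and
    \<open>norm f' \<le> norm (L p) + cmod \<mu> * norm f\<close>.\<close>
  define c where "c = 1 + (1 + cmod \<mu>) / \<bar>Im \<mu>\<bar>"
  have c: "c > 0"
    by (auto simp: c_def intro!: add_pos_nonneg)
  have bd: "inverse c * norm p \<le> norm (L p)" if "p \<in> S" for p
  proof -
    obtain f f' where p: "p = (f, f')" by fastforce
    have 1: "\<bar>Im \<mu>\<bar> * norm f \<le> norm (L p)"
      unfolding L_def p fst_conv snd_conv
      using self_adjointD[OF S, of f f' f f'] that p by (intro symmetric_shift_bound) simp
    have "norm f' = norm (L p + \<mu> *\<^sub>C f)"
      by (simp add: L_def p)
    also have "\<dots> \<le> norm (L p) + cmod \<mu> * norm f"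
      using norm_triangle_ineq[of "L p" "\<mu> *\<^sub>C f"] by simp
    finally have "norm p \<le> norm (L p) + (1 + cmod \<mu>) * norm f"
      using norm_Pair_le[of f f'] p by (simp add: algebra_simps)
    also have "\<dots> \<le> norm (L p) + (1 + cmod \<mu>) * (norm (L p) / \<bar>Im \<mu>\<bar>)"
      using 1 \<mu> by (intro add_left_mono mult_left_mono) (auto simp: field_simps)
    also have "\<dots> = c * norm (L p)"
      by (simp add: c_def algebra_simps)
    finally show ?thesis
      using c by (simp add: field_simps)
  qed
  have "complete (L ` S)"
    using c bd self_adjoint_closed[OF S]
    by (intro complete_isometric_image[of "inverse c"] L csubspace_imp_subspace sub)
      (auto simp: complete_eq_closed)
  then have "closed (L ` S)"
    by (simp add: complete_eq_closed)
  moreover have "cvec.subspace (L ` S)"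
    unfolding cvec.subspace_def
  proof (intro conjI ballI allI)
    show "0 \<in> L ` S"
      using rel_zero[OF sub] by (force simp: L_def)
  next
    fix x y assume "x \<in> L ` S" "y \<in> L ` S"
    then obtain p q where "x = L p" "y = L q" "p \<in> S" "q \<in> S" by blast
    then show "x + y \<in> L ` S"
      using cvec.subspace_add[OF sub, of p q] L[THEN bounded_linear.linear, THEN linear_add, of p q]
      by (metis imageI)
  next
    fix a x assume "x \<in> L ` S"
    then obtain p where "x = L p" "p \<in> S" by blast
    moreover have "L (a *\<^sub>C p) = a *\<^sub>C L p"
      by (simp add: L_def scaleC_prod_def scaleC_scaleC cvec.scale_right_diff_distrib mult.commute)
    ultimately show "a *\<^sub>C x \<in> L ` S"
      using cvec.subspace_scale[OF sub, of p a] by (metis imageI)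
  qed
  ultimately obtain m where m: "m \<in> L ` S" "\<And>x. x \<in> L ` S \<Longrightarrow> cinner (h - m) x = 0"
    using orthogonal_decomposition by blast
  have "(h - m, cnj \<mu> *\<^sub>C (h - m)) \<in> S"
  proof (rule self_adjointI[OF S])
    fix f f' assume "(f, f') \<in> S"
    then have "cinner (h - m) (f' - \<mu> *\<^sub>C f) = 0"
      by (intro m) (force simp: L_def)
    then have "cinner (f' - \<mu> *\<^sub>C f) (h - m) = 0"
      using cinner_commute[of "f' - \<mu> *\<^sub>C f" "h - m"] by simp
    then show "cinner f' (h - m) = cinner f (cnj \<mu> *\<^sub>C (h - m))"
      by (simp add: cinner_diff_left cinner_scaleC_left cinner_scaleC_right)
  qed
  from symmetric_shift_bound[OF self_adjointD[OF S this this], of "cnj \<mu>"] \<mu>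
  have "h = m" by (simp add: mult_le_0_iff)
  with m(1) obtain p where "p \<in> S" "h = L p" by blast
  then show ?thesis
    using that[of p] by (simp add: L_def)
qed

text \<open>
  Since \<open>\<mu>\<close> and \<open>\<nu>\<close> are not assumed conjugate, an element \<open>(u, \<mu> u)\<close> of the adjoint is split along
  \<open>S\<close> and an eigenelement \<open>(w, \<nu> w)\<close>; symmetry then yields \<open>Im \<mu> \<parallel>u\<parallel>\<^sup>2 = Im \<nu> \<parallel>w\<parallel>\<^sup>2\<close>.
\<close>
lemma self_adjoint_if_symmetric_surj:
  assumes S: "cvec.subspace S" "symmetric_rel S"
    and \<mu>: "Im \<mu> > 0" and \<nu>: "Im \<nu> < 0"
    and surj: "\<And>h. \<exists>f f'. (f, f') \<in> S \<and> f' - \<mu> *\<^sub>C f = h" "\<And>h. \<exists>f f'. (f, f') \<in> S \<and> f' - \<nu> *\<^sub>C f = h"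
  shows "self_adjoint S"
proof -
  let ?A = "adjoint_rel S"
  note A = csubspace_adjoint_rel[of S]
  have SA: "S \<subseteq> ?A"
    using S by (simp add: symmetric_rel_def)
  have pair: "cinner f' g = cinner f g'" if "(f, f') \<in> S" "(g, g') \<in> ?A" for f f' g g'
    using that by (auto simp: adjoint_rel_iff)
  have ker: "u = 0" if u: "(u, \<mu> *\<^sub>C u) \<in> ?A" for u
  proof -
    \<comment> \<open>The right-hand side is chosen so that \<open>w = u - f\<close> becomes an
      eigenelement of the adjoint for \<open>\<nu>\<close>.\<close>
    obtain f f' where f: "(f, f') \<in> S" "f' - \<nu> *\<^sub>C f = (\<mu> - \<nu>) *\<^sub>C u"
      using surj(2) by blast
    define w where "w = u - f"
    have f': "f' = \<mu> *\<^sub>C u - \<nu> *\<^sub>C w"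
      using f(2) by (simp add: w_def cvec.scale_left_diff_distrib cvec.scale_right_diff_distrib algebra_simps)
    have w: "(w, \<nu> *\<^sub>C w) \<in> ?A"
      using rel_diff[OF A u, of f f'] f(1) SA by (auto simp: w_def f')
    have fw: "f = u - w"
      by (simp add: w_def)
    define a where "a = cinner u w"
    have wu: "cinner w u = cnj a"
      unfolding a_def by (rule cinner_commute)
    have 1: "\<mu> * cinner u u - \<nu> * cnj a = cnj \<mu> * (cinner u u - cnj a)"
      using pair[OF f(1) u]
      by (simp add: f' fw cinner_diff_left cinner_scaleC_left cinner_scaleC_right wu algebra_simps)
    have 2: "\<mu> * a - \<nu> * cinner w w = cnj \<nu> * (a - cinner w w)"
      using pair[OF f(1) w]
      by (simp add: f' fw cinner_diff_left cinner_scaleC_left cinner_scaleC_right a_def[symmetric] algebra_simps)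
    have "2 * (Im \<mu> * (norm u)\<^sup>2) = Im ((\<nu> - cnj \<mu>) * cnj a)"
      using arg_cong[OF 1, of Im] unfolding cinner_self by (simp add: algebra_simps flip: of_real_power)
    moreover have "2 * (Im \<nu> * (norm w)\<^sup>2) = Im ((\<mu> - cnj \<nu>) * a)"
      using arg_cong[OF 2, of Im] unfolding cinner_self by (simp add: algebra_simps flip: of_real_power)
    \<comment> \<open>Each number is minus the conjugate of the other, so the imaginary parts
      agree.\<close>
    moreover have "Im ((\<nu> - cnj \<mu>) * cnj a) = Im ((\<mu> - cnj \<nu>) * a)"
      by (simp add: algebra_simps)
    ultimately have "Im \<mu> * (norm u)\<^sup>2 = Im \<nu> * (norm w)\<^sup>2" by simp
    moreover have "Im \<nu> * (norm w)\<^sup>2 \<le> 0"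
      using \<nu> by (simp add: mult_nonpos_nonneg)
    ultimately have "Im \<mu> * (norm u)\<^sup>2 \<le> 0" by simp
    then show ?thesis
      using \<mu> by (simp add: mult_le_0_iff)
  qed
  have "?A \<subseteq> S"
  proof (rule subrelI)
    fix g g' assume g: "(g, g') \<in> ?A"
    \<comment> \<open>An element of \<open>S\<close> with the same image under the shift is
      subtracted; the difference is an eigenelement of the adjoint, which \<open>ker\<close>
      kills.\<close>
    obtain f f' where f: "(f, f') \<in> S" "f' - \<mu> *\<^sub>C f = g' - \<mu> *\<^sub>C g"
      using surj(1) by blast
    then have "g' - f' = \<mu> *\<^sub>C (g - f)"
      by (simp add: cvec.scale_right_diff_distrib algebra_simps)
    moreover have "(g - f, g' - f') \<in> ?A"
      using f(1) SA by (intro rel_diff A g) auto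
    ultimately have "g - f = 0"
      by (intro ker) simp
    with \<open>g' - f' = _\<close> f(1) show "(g, g') \<in> S" by simp
  qed
  with SA show ?thesis
    by (auto simp: self_adjoint_def)
qed

section \<open>Inverting a self-adjoint relation up to its kernel\<close>

lemma cinner_eq_0_commute: "cinner x y = 0 \<Longrightarrow> cinner y x = 0"
  using cinner_commute[of y x] by simp

text \<open>\<open>z\<close> splits into \<open>z - p\<close> in the multivalued part,
  \<open>r\<close> in the range of the operator part, and the remainder \<open>k\<close>, which is
  orthogonal to that range and so belongs to the kernel. Closedness of the range permits the second
  projection.\<close>

lemma self_adjoint_range_plus_ker:
  fixes \<Theta> :: "('g::complex_hilbert_space \<times> 'g) set"
  assumes \<Theta>: "self_adjoint \<Theta>" and cl: "closed (Range (op_part \<Theta>))"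
  obtains x y k where "(x, y) \<in> \<Theta>" "(k, 0) \<in> \<Theta>" "z = y + k"
proof -
  note sub = self_adjoint_csubspace[OF \<Theta>]
  define D where "D = Domain \<Theta>"
  define R where "R = Range (op_part \<Theta>)"
  have subD: "cvec.subspace D"
    unfolding cvec.subspace_def D_def using rel_intros[OF sub] by blast
  note subK = csubspace_closure[OF subD]
  have DK: "D \<subseteq> closure D"
    by (rule closure_subset)
  have R_iff: "y \<in> R \<longleftrightarrow> (\<exists>x. (x, y) \<in> \<Theta> \<and> y \<in> closure D)" for y
    using DK by (auto simp: R_def op_part_def D_def)
  have subR: "cvec.subspace R"
    unfolding cvec.subspace_def
  proof (intro conjI ballI allI)
    show "0 \<in> R"
      using rel_zero[OF sub] cvec.subspace_0[OF subK] unfolding R_iff by blast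
  next
    fix x y assume "x \<in> R" "y \<in> R"
    then show "x + y \<in> R"
      using rel_add[OF sub] cvec.subspace_add[OF subK] unfolding R_iff by meson
  next
    fix c x assume "x \<in> R"
    then show "c *\<^sub>C x \<in> R"
      using rel_scale[OF sub] cvec.subspace_scale[OF subK] unfolding R_iff by meson
  qed
  have mul: "(0, m) \<in> \<Theta>" if "\<And>x. x \<in> closure D \<Longrightarrow> cinner m x = 0" for m
    using that DK cinner_eq_0_commute by (intro self_adjointI[OF \<Theta>]) (fastforce simp: D_def)
  obtain p where p: "p \<in> closure D" "\<And>x. x \<in> closure D \<Longrightarrow> cinner (z - p) x = 0"
    using orthogonal_decomposition[OF subK closed_closure] by blast
  obtain r where r: "r \<in> R" "\<And>x. x \<in> R \<Longrightarrow> cinner (p - r) x = 0"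
    using orthogonal_decomposition[OF subR cl[folded R_def]] by blast
  define k where "k = p - r"
  have kK: "k \<in> closure D"
    unfolding k_def using p r R_iff by (intro cvec.subspace_diff subK) auto
  have "(k, 0) \<in> \<Theta>"
  proof (rule self_adjointI[OF \<Theta>])
    fix f f' assume f: "(f, f') \<in> \<Theta>"
    \<comment> \<open>Only orthogonality of \<open>k\<close> to \<open>R\<close> is known, so
      \<open>f'\<close> is first replaced by its projection onto the closed domain; the difference
      is in the multivalued part and orthogonal to \<open>k\<close>.\<close>
    obtain q where q: "q \<in> closure D" "\<And>x. x \<in> closure D \<Longrightarrow> cinner (f' - q) x = 0"
      using orthogonal_decomposition[OF subK closed_closure] by blast
    have "(f, q) \<in> \<Theta>"
      using rel_diff[OF sub f mul[OF q(2)]] by simp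
    then have "q \<in> R"
      using q R_iff by auto
    then have "cinner q k = 0"
      using r(2) cinner_eq_0_commute by (auto simp: k_def)
    moreover have "cinner (f' - q) k = 0"
      by (rule q(2)[OF kK])
    ultimately show "cinner f' k = cinner f 0"
      by (simp add: cinner_diff_left)
  qed
  moreover obtain x where "(x, r) \<in> \<Theta>"
    using r(1) R_iff by auto
  then have "(x, r + (z - p)) \<in> \<Theta>"
    using rel_add[OF sub _ mul[OF p(2)]] by fastforce
  moreover have "z = r + (z - p) + k"
    by (simp add: k_def)
  ultimately show ?thesis
    using that by blast
qed

text \<open>\<open>F\<close> is the orthogonal projection onto the finite-dimensional kernel and
  \<open>B\<close> inverts \<open>\<Theta> + F\<close>; the equivalence expresses this without
  forming a sum of relations.\<close>

lemma self_adjoint_invertible_modulo_compact: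
  fixes \<Theta> :: "('g::complex_hilbert_space \<times> 'g) set"
  assumes \<Theta>: "self_adjoint \<Theta>" and ess: "0 \<notin> ess_spectrum \<Theta>"
  obtains F B where "bounded_linear F" "compact_map F" "bounded_linear B"
    "\<And>z x. x = B z \<longleftrightarrow> (x, z - F x) \<in> \<Theta>"
proof -
  note sub = self_adjoint_csubspace[OF \<Theta>]
  have "shift_rel (op_part \<Theta>) 0 = op_part \<Theta>"
    by (auto simp: shift_rel_def)
  with ess have fred: "fredholm_in (closure (Domain \<Theta>)) (op_part \<Theta>)"
    by (simp add: ess_spectrum_def ess_spectrum_in_def)
  have ker: "ker_rel (op_part \<Theta>) = {k. (k, 0) \<in> \<Theta>}"
    using closure_subset[of "Domain \<Theta>"] rel_zero[OF sub] by (auto simp: ker_rel_def op_part_def)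
  from fred obtain E0 where "finite E0" "cvec.span E0 = {k. (k, 0) \<in> \<Theta>}"
    unfolding fredholm_in_def ker by blast
  then obtain E where E: "finite E" and span: "cvec.span E = {k. (k, 0) \<in> \<Theta>}"
    and on: "\<And>x y. x \<in> E \<Longrightarrow> y \<in> E \<Longrightarrow> cinner x y = (if x = y then 1 else 0)"
    using orthonormal_basis_finite_span by metis
  define F where "F x = (\<Sum>e\<in>E. cinner x e *\<^sub>C e)" for x
  have blF: "bounded_linear F"
    unfolding F_def
    by (intro bounded_linear_sum
      bounded_linear_compose[OF bounded_bilinear.bounded_linear_left[OF bounded_bilinear_scaleC]]
      bounded_bilinear.bounded_linear_left[OF bounded_bilinear_cinner])
  interpret F: bounded_linear F by (rule blF)
  have cF: "compact_map F"
    unfolding F_def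
  proof (rule compact_map_sum)
    fix e :: 'g
    have "compact_map (\<lambda>x. cinner x e)"
      unfolding compact_map_def
    proof (intro allI impI)
      fix x :: "nat \<Rightarrow> 'g" assume "bounded (range x)"
      from bounded_linear_image[OF this bounded_bilinear.bounded_linear_left[OF bounded_bilinear_cinner]]
      have "bounded (range (\<lambda>n. cinner (x n) e))"
        by (simp add: image_image)
      from bounded_imp_convergent_subsequence[OF this]
      show "\<exists>r l. strict_mono r \<and> (\<lambda>n. cinner (x (r n)) e) \<longlonglongrightarrow> l"
        by (auto simp: o_def)
    qed
    then show "compact_map (\<lambda>x. cinner x e *\<^sub>C e)"
      by (rule compact_map_compose) (auto simp: isCont_def intro: tendsto_scaleC)
  qed
  have symF: "cinner (F x) y = cinner x (F y)" for x y
    unfolding F_def cinner_sum_left cinner_sum_right cinner_scaleC_left cinner_scaleC_right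
    by (simp add: cinner_commute[of _ y, symmetric] mult.commute)
  have Fker: "(F x, 0) \<in> \<Theta>" for x
  proof -
    have "F x \<in> cvec.span E"
      unfolding F_def by (intro cvec.span_sum cvec.span_scale cvec.span_base)
    then show ?thesis by (simp add: span)
  qed
  have Fid: "F x = x" if "(x, 0) \<in> \<Theta>" for x
  proof -
    have "x \<in> cvec.span E"
      using that by (simp add: span)
    then show ?thesis
    proof (induction rule: cvec.span_induct_alt)
      case base
      show ?case by (rule F.zero)
    next
      case (step c e y)
      have "F (c *\<^sub>C e) = (\<Sum>x\<in>E. if x = e then c *\<^sub>C e else 0)"
        unfolding F_def using step(1) by (intro sum.cong) (auto simp: cinner_scaleC_left on)
      then have "F (c *\<^sub>C e) = c *\<^sub>C e"
        using step(1) E by simp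
      with step show ?case
        by (simp add: F.add)
    qed
  qed
  have ex: "\<exists>x. (x, z - F x) \<in> \<Theta>" for z
  proof -
    obtain x y k where xy: "(x, y) \<in> \<Theta>" and k: "(k, 0) \<in> \<Theta>" and z: "z = y + k"
      using self_adjoint_range_plus_ker[OF \<Theta>] fred unfolding fredholm_in_def by metis
    have "F (x - F x + k) = k"
      by (simp add: F.add F.diff Fid[OF Fker] Fid[OF k])
    moreover have "(x - F x + k, y - 0 + 0) \<in> \<Theta>"
      by (intro rel_add[OF sub] rel_diff[OF sub] xy Fker k)
    \<comment> \<open>The kernel component \<open>F x\<close> is exchanged for \<open>k\<close>: the
      image stays \<open>y\<close>, while \<open>F\<close> now takes the value
      \<open>k\<close>.\<close>
    ultimately show ?thesis
      by (intro exI[of _ "x - F x + k"]) (simp add: z)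
  qed
  have uniq: "x = x'" if x: "(x, z - F x) \<in> \<Theta>" and x': "(x', z - F x') \<in> \<Theta>" for x x' z
  proof -
    define d where "d = x - x'"
    have d: "(d, - F d) \<in> \<Theta>"
      using rel_diff[OF sub x x'] by (simp add: d_def F.diff)
    \<comment> \<open>The range of \<open>\<Theta>\<close> is orthogonal to its kernel, and
      \<open>- F d\<close> lies in both. Then \<open>d\<close> itself is in the kernel and equals
      \<open>F d = 0\<close>.\<close>
    have "cinner (- F d) (F d) = cinner d 0"
      by (rule self_adjointD[OF \<Theta> d Fker])
    then have "F d = 0"
      by (simp add: cinner_minus_left cinner_self)
    with d Fid[of d] show ?thesis
      by (simp add: d_def)
  qed
  obtain B where B: "\<And>z. (B z, z - F (B z)) \<in> \<Theta>"
    using ex by metis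
  have "cinner (B z) w = cinner z (B w)" for z w
    using self_adjointD[OF \<Theta> B[of z] B[of w]]
    by (simp add: cinner_diff_left cinner_diff_right symF)
  then have "bounded_linear B"
    by (rule Hellinger_Toeplitz)
  moreover have "x = B z \<longleftrightarrow> (x, z - F x) \<in> \<Theta>" for z x
    using B uniq by blast
  ultimately show ?thesis
    using blF cF that by blast
qed

section \<open>Compact operators as closures of relations\<close>

text \<open>Extension by continuity: the bound survives closure and makes it single-valued, while
  density and completeness make it everywhere defined.\<close>

lemma closure_bounded_relation:
  fixes W :: "('g::complex_hilbert_space \<times> 'g) set"
  assumes W: "cvec.subspace W" and dense: "closure (Domain W) = UNIV"
    and bound: "\<And>x y. (x, y) \<in> W \<Longrightarrow> norm y \<le> C * norm x"
  obtains N where "bounded_linear N" "\<And>x y. (x, y) \<in> closure W \<longleftrightarrow> y = N x"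
proof -
  note sub = csubspace_closure[OF W]
  have "closed {p :: 'g \<times> 'g. norm (snd p) \<le> C * norm (fst p)}"
    by (intro closed_Collect_le continuous_intros)
  then have "closure W \<subseteq> {p. norm (snd p) \<le> C * norm (fst p)}"
    using bound by (intro closure_minimal) auto
  then have bd: "norm y \<le> C * norm x" if "(x, y) \<in> closure W" for x y
    using that by auto
  have ex: "\<exists>y. (x, y) \<in> closure W" for x
  proof -
    obtain u where u: "\<And>n. u n \<in> Domain W" "u \<longlonglongrightarrow> x"
      using dense closure_sequential[of x "Domain W"] by auto
    then obtain v where v: "\<And>n. (u n, v n) \<in> W"
      by (meson DomainE)
    have "Cauchy v"
    proof (rule CauchyI)
      fix e :: real assume e: "e > 0"
      \<comment> \<open>The divisor is \<open>1 + \<bar>C\<bar>\<close> because \<open>C\<close> may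
        be zero or negative.\<close>
      define d where "d = e / (1 + \<bar>C\<bar>)"
      have "d > 0"
        using e by (simp add: d_def)
      then obtain M where M: "\<And>m n. m \<ge> M \<Longrightarrow> n \<ge> M \<Longrightarrow> norm (u m - u n) < d"
        using CauchyD[OF LIMSEQ_imp_Cauchy[OF u(2)]] by blast
      have "norm (v m - v n) < e" if "m \<ge> M" "n \<ge> M" for m n
      proof -
        have "norm (v m - v n) \<le> C * norm (u m - u n)"
          by (intro bound rel_diff W v)
        also have "\<dots> \<le> (1 + \<bar>C\<bar>) * norm (u m - u n)"
          by (intro mult_right_mono) auto
        also have "\<dots> < (1 + \<bar>C\<bar>) * d"
          using M[OF that] by (intro mult_strict_left_mono) auto
        also have "\<dots> = e"
          by (simp add: d_def)
        finally show ?thesis .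
      qed
      then show "\<exists>M. \<forall>m\<ge>M. \<forall>n\<ge>M. norm (v m - v n) < e" by blast
    qed
    then obtain y where "v \<longlonglongrightarrow> y"
      using Cauchy_convergent_iff convergent_def by blast
    with u(2) have "(\<lambda>n. (u n, v n)) \<longlonglongrightarrow> (x, y)"
      by (rule tendsto_Pair)
    with v show ?thesis
      unfolding closure_sequential by (intro exI[of _ y] exI[of _ "\<lambda>n. (u n, v n)"]) simp
  qed
  then obtain N where N: "\<And>x. (x, N x) \<in> closure W" by metis
  have iff: "(x, y) \<in> closure W \<longleftrightarrow> y = N x" for x y
  proof
    assume "(x, y) \<in> closure W"
    from bd[OF rel_diff[OF sub this N[of x]]] show "y = N x" by simp
  qed (use N in simp)
  have "bounded_linear N"
  proof (rule bounded_linear_intro)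
    show "N (x + y) = N x + N y" for x y
      using rel_add[OF sub N N] iff by metis
    show "N (r *\<^sub>R x) = r *\<^sub>R N x" for r x
      using rel_scale[OF sub N] iff by (metis scaleR_scaleC)
    show "norm (N x) \<le> norm x * C" for x
      using bd[OF N] by (simp add: mult.commute)
  qed
  with iff show ?thesis
    using that by blast
qed

lemma compact_operator_bounded:
  assumes "compact_operator K"
  obtains C where "C \<ge> 0" "\<And>x y. (x, y) \<in> K \<Longrightarrow> norm y \<le> C * norm x"
proof -
  have sub: "cvec.subspace K" and mul: "\<And>y. (0, y) \<in> K \<Longrightarrow> y = 0"
    and cpt: "compact (closure (K `` cball 0 1))"
    using assms by (auto simp: compact_operator_def linear_relation_def mul_rel_def)
  have "bounded (K `` cball 0 1)"
    by (rule bounded_subset[OF compact_imp_bounded[OF cpt] closure_subset])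
  then obtain C where C: "C > 0" "\<And>y. y \<in> K `` cball 0 1 \<Longrightarrow> norm y \<le> C"
    unfolding bounded_pos by blast
  have "norm y \<le> C * norm x" if xy: "(x, y) \<in> K" for x y
  proof (cases "x = 0")
    case False
    have "(inverse (norm x) *\<^sub>R x, inverse (norm x) *\<^sub>R y) \<in> K"
      using rel_scale[OF sub xy] by (simp add: scaleR_scaleC)
    then have "inverse (norm x) *\<^sub>R y \<in> K `` cball 0 1"
      using False by (intro ImageI) auto
    from C(2)[OF this] False show ?thesis
      by (simp add: field_simps)
  qed (use mul xy in auto)
  with C(1) show ?thesis
    using that[of C] by simp
qed

lemma compact_operator_compact_map:
  assumes K: "compact_operator K" and N: "bounded_linear N" "\<And>x. (x, N x) \<in> K"
  shows "compact_map N"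
  unfolding compact_map_def
proof (intro allI impI)
  interpret N: bounded_linear N by (rule N)
  fix x :: "nat \<Rightarrow> 'a" assume "bounded (range x)"
  then obtain b where b: "b > 0" "\<And>n. norm (x n) \<le> b"
    using bounded_pos by (metis rangeI)
  \<comment> \<open>Dividing by \<open>b\<close> moves the sequence into the unit ball, whose image
    is relatively compact.\<close>
  let ?S = "closure (K `` cball 0 1)" and ?f = "\<lambda>n. N (x n /\<^sub>R b)"
  have f: "\<forall>n. ?f n \<in> ?S"
  proof
    fix n show "?f n \<in> ?S"
      using b N(2) by (intro subsetD[OF closure_subset] ImageI[of "x n /\<^sub>R b"]) (auto simp: field_simps)
  qed
  have "compact ?S"
    using K by (simp add: compact_operator_def)
  from spec[OF this[unfolded compact_def], of ?f] f
  have "\<exists>l\<in>?S. \<exists>r. strict_mono r \<and> (?f \<circ> r) \<longlonglongrightarrow> l"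
    by (rule mp)
  then obtain l r where r: "strict_mono r" and l: "(\<lambda>n. N (x (r n) /\<^sub>R b)) \<longlonglongrightarrow> l"
    by (auto simp: o_def)
  have "(\<lambda>n. b *\<^sub>R N (x (r n) /\<^sub>R b)) \<longlonglongrightarrow> b *\<^sub>R l"
    by (intro tendsto_intros l)
  then have "(\<lambda>n. N (x (r n))) \<longlonglongrightarrow> b *\<^sub>R l"
    using b by (simp add: N.scaleR)
  with r show "\<exists>r l. strict_mono r \<and> (\<lambda>n. N (x (r n))) \<longlonglongrightarrow> l" by blast
qed

text \<open>On bounded sequences the right-hand side of \<open>est\<close>, applied to differences,
  tends to 0 whenever the values of \<open>N0\<close> form a Cauchy sequence; then the values of
  \<open>N\<close> do too.\<close>

lemma compact_map_dominated:
  fixes N N0 :: "'a::real_normed_vector \<Rightarrow> 'b::banach"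
  assumes N: "linear N" and N0: "linear N0" "compact_map N0"
    and est: "\<And>x. norm (N x) \<le> norm (N0 x) + C * sqrt (norm (N0 x) * norm x)"
    and C: "C \<ge> 0"
  shows "compact_map N"
  unfolding compact_map_def
proof (intro allI impI)
  fix x :: "nat \<Rightarrow> 'a" assume x: "bounded (range x)"
  then obtain b where b: "b > 0" "\<And>n. norm (x n) \<le> b"
    using bounded_pos by (metis rangeI)
  from x N0(2) obtain r l where r: "strict_mono r" and l: "(\<lambda>n. N0 (x (r n))) \<longlonglongrightarrow> l"
    using compact_mapD by blast
  have "Cauchy (\<lambda>n. N (x (r n)))"
  proof (rule CauchyI)
    fix e :: real assume e: "e > 0"
    \<comment> \<open>\<open>2 * b\<close> bounds the norm of a difference of two terms, so
      \<open>g\<close> dominates the estimate; it is continuous and vanishes at 0.\<close>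
    define g where "g t = t + C * sqrt (t * (2 * b))" for t
    have "isCont g 0"
      unfolding g_def by (intro continuous_intros)
    then have "g \<midarrow>0\<rightarrow> 0"
      by (simp add: isCont_def g_def)
    from LIM_D[OF this e] obtain d where d: "d > 0" "\<And>t. t \<noteq> 0 \<Longrightarrow> \<bar>t\<bar> < d \<Longrightarrow> \<bar>g t\<bar> < e"
      by auto
    have g_less: "g t < e" if "0 \<le> t" "t < d" for t
      using d(2)[of t] that e by (cases "t = 0") (auto simp: g_def)
    from CauchyD[OF LIMSEQ_imp_Cauchy[OF l] d(1)] obtain M
      where M: "\<And>m n. m \<ge> M \<Longrightarrow> n \<ge> M \<Longrightarrow> norm (N0 (x (r m)) - N0 (x (r n))) < d"
      by blast
    have "norm (N (x (r m)) - N (x (r n))) < e" if "m \<ge> M" "n \<ge> M" for m n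
    proof -
      let ?z = "x (r m) - x (r n)"
      have "norm ?z \<le> 2 * b"
        using norm_triangle_ineq4[of "x (r m)" "x (r n)"] b(2)[of "r m"] b(2)[of "r n"] by simp
      then have "C * sqrt (norm (N0 ?z) * norm ?z) \<le> C * sqrt (norm (N0 ?z) * (2 * b))"
        by (intro mult_left_mono real_sqrt_le_mono C) auto
      with est[of ?z] have "norm (N ?z) \<le> g (norm (N0 ?z))"
        by (simp add: g_def)
      also have "\<dots> < e"
        using M[OF that] by (intro g_less) (auto simp: linear_diff[OF N0(1)])
      finally show ?thesis
        by (simp add: linear_diff[OF N])
    qed
    then show "\<exists>M. \<forall>m\<ge>M. \<forall>n\<ge>M. norm (N (x (r m)) - N (x (r n))) < e" by blast
  qed
  then show "\<exists>r l. strict_mono r \<and> (\<lambda>n. N (x (r n))) \<longlonglongrightarrow> l"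
    using r Cauchy_convergent_iff convergent_def by blast
qed

lemma clinear_on_diff:
  assumes "clinear_on T f" "cvec.subspace T" "x \<in> T" "y \<in> T"
  shows "f (x - y) = f x - f y"
proof -
  have "f (x + (- 1) *\<^sub>C y) = f x + f ((- 1) *\<^sub>C y)"
    using assms cvec.subspace_scale[of T y "- 1"] unfolding clinear_on_def by blast
  also have "f ((- 1) *\<^sub>C y) = (- 1) *\<^sub>C f y"
    using assms unfolding clinear_on_def by blast
  finally show ?thesis by simp
qed

section \<open>Quasi boundary triples\<close>

locale quasi_triple =
  fixes A T :: "('h::complex_hilbert_space \<times> 'h) set"
    and \<Gamma>\<^sub>0 \<Gamma>\<^sub>1 :: "'h \<times> 'h \<Rightarrow> 'g::complex_hilbert_space"
  assumes qbt: "quasi_boundary_triple A T \<Gamma>\<^sub>0 \<Gamma>\<^sub>1"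
begin

lemma subT: "cvec.subspace T"
  using qbt by (simp add: quasi_boundary_triple_def linear_relation_def)

lemma clinear: "clinear_on T \<Gamma>\<^sub>0" "clinear_on T \<Gamma>\<^sub>1"
  using qbt by (simp_all add: quasi_boundary_triple_def)

lemma boundary_add:
  assumes "p \<in> T" "q \<in> T"
  shows "\<Gamma>\<^sub>0 (p + q) = \<Gamma>\<^sub>0 p + \<Gamma>\<^sub>0 q" "\<Gamma>\<^sub>1 (p + q) = \<Gamma>\<^sub>1 p + \<Gamma>\<^sub>1 q"
  using clinear assms by (simp_all add: clinear_on_def)

lemma boundary_scale:
  assumes "p \<in> T"
  shows "\<Gamma>\<^sub>0 (c *\<^sub>C p) = c *\<^sub>C \<Gamma>\<^sub>0 p" "\<Gamma>\<^sub>1 (c *\<^sub>C p) = c *\<^sub>C \<Gamma>\<^sub>1 p"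
  using clinear assms by (simp_all add: clinear_on_def)

lemmas boundary_diff = clinear_on_diff[OF clinear(1) subT] clinear_on_diff[OF clinear(2) subT]

lemma boundary_zero: "\<Gamma>\<^sub>0 0 = 0" "\<Gamma>\<^sub>1 0 = 0"
  using boundary_diff[of 0 0] cvec.subspace_0[OF subT] by auto

lemma green:
  assumes "p \<in> T" "q \<in> T"
  shows "cinner (snd p) (fst q) - cinner (fst p) (snd q) =
    cinner (\<Gamma>\<^sub>1 p) (\<Gamma>\<^sub>0 q) - cinner (\<Gamma>\<^sub>0 p) (\<Gamma>\<^sub>1 q)"
proof -
  have "\<forall>p\<in>T. \<forall>q\<in>T. cinner (snd p) (fst q) - cinner (fst p) (snd q) =
      cinner (\<Gamma>\<^sub>1 p) (\<Gamma>\<^sub>0 q) - cinner (\<Gamma>\<^sub>0 p) (\<Gamma>\<^sub>1 q)"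
    using qbt by (simp add: quasi_boundary_triple_def case_prod_beta)
  with assms show ?thesis by blast
qed

lemma self_adjoint_ker0: "self_adjoint {f \<in> T. \<Gamma>\<^sub>0 f = 0}"
  using qbt by (simp add: quasi_boundary_triple_def)

lemma dense_range0: "closure (\<Gamma>\<^sub>0 ` T) = UNIV"
proof -
  let ?X = "(\<lambda>f. (\<Gamma>\<^sub>0 f, \<Gamma>\<^sub>1 f)) ` T"
  have "fst ` closure ?X \<subseteq> closure (\<Gamma>\<^sub>0 ` T)"
  proof (rule image_closure_subset)
    show "fst ` ?X \<subseteq> closure (\<Gamma>\<^sub>0 ` T)"
      using closure_subset[of "\<Gamma>\<^sub>0 ` T"] by (auto simp: image_image)
  qed (intro continuous_intros closed_closure)+
  moreover have "closure ?X = UNIV"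
    using qbt by (simp add: quasi_boundary_triple_def)
  ultimately show ?thesis
    by (auto simp: image_def)
qed

section \<open>Defect elements and the Weyl function\<close>

lemma defect_iff: "p \<in> defect_rel T \<mu> \<longleftrightarrow> p \<in> T \<and> snd p = \<mu> *\<^sub>C fst p"
  by (cases p) (auto simp: defect_rel_def ker_rel_def shift_rel_def)

lemma subspace_defect: "cvec.subspace (defect_rel T \<mu>)"
  unfolding cvec.subspace_def
proof (intro conjI ballI allI)
  show "0 \<in> defect_rel T \<mu>"
    by (simp add: defect_iff cvec.subspace_0[OF subT])
next
  fix p q assume "p \<in> defect_rel T \<mu>" "q \<in> defect_rel T \<mu>"
  then show "p + q \<in> defect_rel T \<mu>"
    by (simp add: defect_iff cvec.subspace_add[OF subT] scaleC_add_right)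
next
  fix c p assume "p \<in> defect_rel T \<mu>"
  then show "c *\<^sub>C p \<in> defect_rel T \<mu>"
    by (simp add: defect_iff cvec.subspace_scale[OF subT] fst_scaleC snd_scaleC scaleC_scaleC mult.commute)
qed

lemma ker0_shift_bound:
  assumes "k \<in> T" "\<Gamma>\<^sub>0 k = 0"
  shows "\<bar>Im \<mu>\<bar> * norm (fst k) \<le> norm (snd k - \<mu> *\<^sub>C fst k)"
  using self_adjointD[OF self_adjoint_ker0, of "fst k" "snd k" "fst k" "snd k"] assms
  by (intro symmetric_shift_bound) simp

text \<open>The difference of two defect elements with equal \<open>\<Gamma>\<^sub>0\<close>-value
  is an eigenelement of the self-adjoint kernel of \<open>\<Gamma>\<^sub>0\<close> at a non-real
  point.\<close>

lemma inj_on_defect: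
  assumes "Im \<mu> \<noteq> 0"
  shows "inj_on \<Gamma>\<^sub>0 (defect_rel T \<mu>)"
proof (rule inj_onI)
  fix p q assume p: "p \<in> defect_rel T \<mu>" and q: "q \<in> defect_rel T \<mu>" and eq: "\<Gamma>\<^sub>0 p = \<Gamma>\<^sub>0 q"
  define k where "k = p - q"
  have k: "k \<in> T" "snd k = \<mu> *\<^sub>C fst k"
    using cvec.subspace_diff[OF subspace_defect p q] by (simp_all add: k_def defect_iff)
  moreover have "\<Gamma>\<^sub>0 k = 0"
    using p q eq by (simp add: k_def boundary_diff defect_iff)
  ultimately have "fst k = 0"
    using ker0_shift_bound[of k \<mu>] assms by (simp add: mult_le_0_iff)
  with k show "p = q"
    by (simp add: k_def prod_eq_iff)
qed

text \<open>\<open>T\<close> is the sum of the kernel of \<open>\<Gamma>\<^sub>0\<close> and the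
  defect elements: subtracting from \<open>q\<close> a kernel element with the same shifted image
  keeps \<open>\<Gamma>\<^sub>0 q\<close>.\<close>

lemma ex_defect:
  assumes "Im \<mu> \<noteq> 0" "\<phi> \<in> \<Gamma>\<^sub>0 ` T"
  obtains p where "p \<in> defect_rel T \<mu>" "\<Gamma>\<^sub>0 p = \<phi>"
proof -
  obtain q where q: "q \<in> T" "\<phi> = \<Gamma>\<^sub>0 q"
    using assms by blast
  obtain f where f: "f \<in> T" "\<Gamma>\<^sub>0 f = 0" "snd f - \<mu> *\<^sub>C fst f = snd q - \<mu> *\<^sub>C fst q"
    using self_adjoint_range_shift[OF self_adjoint_ker0 assms(1), of "snd q - \<mu> *\<^sub>C fst q"] by blast
  have "snd q - snd f = \<mu> *\<^sub>C (fst q - fst f)"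
    using f(3) by (simp add: cvec.scale_right_diff_distrib algebra_simps)
  then have "q - f \<in> defect_rel T \<mu>"
    using cvec.subspace_diff[OF subT q(1) f(1)] by (simp add: defect_iff)
  moreover have "\<Gamma>\<^sub>0 (q - f) = \<phi>"
    using q f by (simp add: boundary_diff)
  ultimately show ?thesis by (rule that)
qed

lemma weyl_iff:
  assumes "Im \<mu> \<noteq> 0"
  shows "(x, y) \<in> weyl T \<Gamma>\<^sub>0 \<Gamma>\<^sub>1 \<mu> \<longleftrightarrow> (\<exists>p\<in>defect_rel T \<mu>. \<Gamma>\<^sub>0 p = x \<and> \<Gamma>\<^sub>1 p = y)"
proof
  assume "(x, y) \<in> weyl T \<Gamma>\<^sub>0 \<Gamma>\<^sub>1 \<mu>"
  then have x: "x \<in> \<Gamma>\<^sub>0 ` T" and y: "y = \<Gamma>\<^sub>1 (inv_into (defect_rel T \<mu>) \<Gamma>\<^sub>0 x)"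
    by (auto simp: weyl_def)
  obtain p where "p \<in> defect_rel T \<mu>" "\<Gamma>\<^sub>0 p = x"
    using ex_defect[OF assms x] .
  with y show "\<exists>p\<in>defect_rel T \<mu>. \<Gamma>\<^sub>0 p = x \<and> \<Gamma>\<^sub>1 p = y"
    using inj_on_defect[OF assms] by (auto simp: inv_into_f_f)
next
  assume "\<exists>p\<in>defect_rel T \<mu>. \<Gamma>\<^sub>0 p = x \<and> \<Gamma>\<^sub>1 p = y"
  then show "(x, y) \<in> weyl T \<Gamma>\<^sub>0 \<Gamma>\<^sub>1 \<mu>"
    using inj_on_defect[OF assms] by (auto simp: weyl_def inv_into_f_f defect_iff)
qed

lemma Domain_weyl: "Domain (weyl T \<Gamma>\<^sub>0 \<Gamma>\<^sub>1 \<mu>) = \<Gamma>\<^sub>0 ` T"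
  by (auto simp: weyl_def)

lemma subspace_weyl:
  assumes "Im \<mu> \<noteq> 0"
  shows "cvec.subspace (weyl T \<Gamma>\<^sub>0 \<Gamma>\<^sub>1 \<mu>)"
proof -
  have "weyl T \<Gamma>\<^sub>0 \<Gamma>\<^sub>1 \<mu> = (\<lambda>p. (\<Gamma>\<^sub>0 p, \<Gamma>\<^sub>1 p)) ` defect_rel T \<mu>"
    using weyl_iff[OF assms] by auto
  moreover have "cvec.subspace \<dots>"
    unfolding cvec.subspace_def
  proof (intro conjI ballI allI)
    show "0 \<in> (\<lambda>p. (\<Gamma>\<^sub>0 p, \<Gamma>\<^sub>1 p)) ` defect_rel T \<mu>"
      using boundary_zero cvec.subspace_0[OF subspace_defect] by (force simp: zero_prod_def)
  next
    fix u v assume "u \<in> (\<lambda>p. (\<Gamma>\<^sub>0 p, \<Gamma>\<^sub>1 p)) ` defect_rel T \<mu>" "v \<in> (\<lambda>p. (\<Gamma>\<^sub>0 p, \<Gamma>\<^sub>1 p)) ` defect_rel T \<mu>"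
    then obtain p q where "p \<in> defect_rel T \<mu>" "q \<in> defect_rel T \<mu>"
      "u = (\<Gamma>\<^sub>0 p, \<Gamma>\<^sub>1 p)" "v = (\<Gamma>\<^sub>0 q, \<Gamma>\<^sub>1 q)" by blast
    then show "u + v \<in> (\<lambda>p. (\<Gamma>\<^sub>0 p, \<Gamma>\<^sub>1 p)) ` defect_rel T \<mu>"
      using cvec.subspace_add[OF subspace_defect, of p \<mu> q]
      by (intro image_eqI[of _ _ "p + q"]) (auto simp: boundary_add defect_iff)
  next
    fix c u assume "u \<in> (\<lambda>p. (\<Gamma>\<^sub>0 p, \<Gamma>\<^sub>1 p)) ` defect_rel T \<mu>"
    then obtain p where "p \<in> defect_rel T \<mu>" "u = (\<Gamma>\<^sub>0 p, \<Gamma>\<^sub>1 p)" by blast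
    then show "c *\<^sub>C u \<in> (\<lambda>p. (\<Gamma>\<^sub>0 p, \<Gamma>\<^sub>1 p)) ` defect_rel T \<mu>"
      using cvec.subspace_scale[OF subspace_defect, of p \<mu> c]
      by (intro image_eqI[of _ _ "c *\<^sub>C p"])
        (auto simp: boundary_scale defect_iff scaleC_prod_def[of _ "(_, _)"])
  qed
  ultimately show ?thesis by simp
qed

text \<open>Green's identity with \<open>p\<close> in both slots. It serves twice: to bound the
  gamma field and to show injectivity in the Fredholm argument.\<close>

lemma Im_weyl:
  assumes "p \<in> defect_rel T \<mu>"
  shows "Im (cinner (\<Gamma>\<^sub>1 p) (\<Gamma>\<^sub>0 p)) = Im \<mu> * (norm (fst p))\<^sup>2"
proof -
  have p: "p \<in> T" "snd p = \<mu> *\<^sub>C fst p"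
    using assms by (simp_all add: defect_iff)
  have c: "cinner (\<Gamma>\<^sub>0 p) (\<Gamma>\<^sub>1 p) = cnj (cinner (\<Gamma>\<^sub>1 p) (\<Gamma>\<^sub>0 p))"
    by (rule cinner_commute)
  have "\<mu> * cinner (fst p) (fst p) - cnj \<mu> * cinner (fst p) (fst p)
      = cinner (\<Gamma>\<^sub>1 p) (\<Gamma>\<^sub>0 p) - cnj (cinner (\<Gamma>\<^sub>1 p) (\<Gamma>\<^sub>0 p))"
    using green[OF p(1) p(1)] unfolding p(2) cinner_scaleC_left cinner_scaleC_right c .
  from arg_cong[OF this, of Im] show ?thesis
    unfolding cinner_self minus_complex.sel Im_complex_of_real times_complex.sel Re_complex_of_real
      cnj.sel by simp
qed

text \<open>For a defect element \<open>p\<close>, \<open>fst p\<close> is the value of the gamma field at \<open>\<Gamma>\<^sub>0 p\<close>.\<close>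
lemma defect_norm_le:
  assumes "Im \<mu> \<noteq> 0" "p \<in> defect_rel T \<mu>" "q \<in> defect_rel T \<nu>" "\<Gamma>\<^sub>0 p = \<Gamma>\<^sub>0 q"
  shows "norm (fst p) \<le> (1 + cmod (\<mu> - \<nu>) / \<bar>Im \<mu>\<bar>) * norm (fst q)"
proof -
  define k where "k = p - q"
  have p: "p \<in> T" "snd p = \<mu> *\<^sub>C fst p" and q: "q \<in> T" "snd q = \<nu> *\<^sub>C fst q"
    using assms(2,3) by (simp_all add: defect_iff)
  have "snd k - \<mu> *\<^sub>C fst k = (\<mu> - \<nu>) *\<^sub>C fst q"
    by (simp add: k_def p q cvec.scale_left_diff_distrib cvec.scale_right_diff_distrib)
  moreover have "k \<in> T"
    unfolding k_def by (rule cvec.subspace_diff[OF subT p(1) q(1)])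
  moreover have "\<Gamma>\<^sub>0 k = 0"
    unfolding k_def boundary_diff(1)[OF p(1) q(1)] assms(4) by simp
  ultimately have "\<bar>Im \<mu>\<bar> * norm (fst k) \<le> norm ((\<mu> - \<nu>) *\<^sub>C fst q)"
    using ker0_shift_bound[of k \<mu>] by metis
  then have "\<bar>Im \<mu>\<bar> * norm (fst p - fst q) \<le> cmod (\<mu> - \<nu>) * norm (fst q)"
    by (simp add: k_def)
  then have "norm (fst p - fst q) \<le> cmod (\<mu> - \<nu>) / \<bar>Im \<mu>\<bar> * norm (fst q)"
    using assms(1) by (simp add: field_simps)
  then show ?thesis
    using norm_triangle_ineq[of "fst p - fst q" "fst q"] by (simp add: algebra_simps)
qed

text \<open>
  The identity behind the bound is \<open>M(\<mu>) - M(\<nu>) = (\<mu> - \<nu>) \<gamma>(\<mu>\<^sup>*)\<^sup>* \<gamma>(\<nu>)\<close> for the gamma field \<open>\<gamma>\<close>,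
  together with \<open>Im \<nu> \<parallel>\<gamma>(\<nu>)x\<parallel>\<^sup>2 = Im (M(\<nu>)x, x)\<close>.
\<close>
lemma weyl_difference_bound:
  assumes \<mu>: "Im \<mu> \<noteq> 0" and \<nu>: "Im \<nu> \<noteq> 0" and C: "C \<ge> 0"
    and bound: "\<And>x y. (x, y) \<in> weyl T \<Gamma>\<^sub>0 \<Gamma>\<^sub>1 \<nu> \<Longrightarrow> norm y \<le> C * norm x"
  obtains c where "c \<ge> 0" "\<And>x y z. (x, y) \<in> weyl T \<Gamma>\<^sub>0 \<Gamma>\<^sub>1 \<mu> \<Longrightarrow> (x, z) \<in> weyl T \<Gamma>\<^sub>0 \<Gamma>\<^sub>1 \<nu> \<Longrightarrow>
    norm (y - z) \<le> c * sqrt (norm z * norm x)"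
proof -
  define a where "a = sqrt (inverse \<bar>Im \<nu>\<bar>)"
  have a: "a \<ge> 0"
    by (simp add: a_def)
  \<comment> \<open>\<open>Im_weyl\<close> controls the square of the gamma field, hence the square
    root.\<close>
  have gam: "norm (fst q) \<le> a * sqrt (norm (\<Gamma>\<^sub>1 q) * norm (\<Gamma>\<^sub>0 q))" if q: "q \<in> defect_rel T \<nu>" for q
  proof -
    have "\<bar>Im \<nu>\<bar> * (norm (fst q))\<^sup>2 = \<bar>Im (cinner (\<Gamma>\<^sub>1 q) (\<Gamma>\<^sub>0 q))\<bar>"
      using Im_weyl[OF q] by (simp add: abs_mult)
    also have "\<dots> \<le> norm (\<Gamma>\<^sub>1 q) * norm (\<Gamma>\<^sub>0 q)"
      using abs_Im_le_cmod cinner_Cauchy_Schwarz order_trans by blast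
    finally have "(norm (fst q))\<^sup>2 \<le> inverse \<bar>Im \<nu>\<bar> * (norm (\<Gamma>\<^sub>1 q) * norm (\<Gamma>\<^sub>0 q))"
      using \<nu> by (simp add: field_simps)
    then have "norm (fst q) \<le> sqrt (inverse \<bar>Im \<nu>\<bar> * (norm (\<Gamma>\<^sub>1 q) * norm (\<Gamma>\<^sub>0 q)))"
      by (rule real_le_rsqrt)
    then show ?thesis
      by (simp add: a_def real_sqrt_mult)
  qed
  define m where "m = 1 + cmod (cnj \<mu> - \<nu>) / \<bar>Im \<mu>\<bar>"
  have m: "m \<ge> 0"
    by (simp add: m_def)
  \<comment> \<open>The factors are \<open>\<mu> - \<nu>\<close>, the bound \<open>a\<close> for the
    gamma field at \<open>\<nu>\<close>, and the bound for the gamma field at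
    \<open>cnj \<mu>\<close>, compared with the one at \<open>\<nu>\<close> through
    \<open>m\<close>.\<close>
  define c where "c = cmod (\<mu> - \<nu>) * a * (m * (a * sqrt C))"
  have c: "c \<ge> 0"
    using a m C by (simp add: c_def)
  have "norm (y - z) \<le> c * sqrt (norm z * norm x)"
    if xy: "(x, y) \<in> weyl T \<Gamma>\<^sub>0 \<Gamma>\<^sub>1 \<mu>" and xz: "(x, z) \<in> weyl T \<Gamma>\<^sub>0 \<Gamma>\<^sub>1 \<nu>" for x y z
  proof -
    obtain p where p: "p \<in> defect_rel T \<mu>" "\<Gamma>\<^sub>0 p = x" "\<Gamma>\<^sub>1 p = y"
      using xy weyl_iff[OF \<mu>] by auto
    obtain q where q: "q \<in> defect_rel T \<nu>" "\<Gamma>\<^sub>0 q = x" "\<Gamma>\<^sub>1 q = z"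
      using xz weyl_iff[OF \<nu>] by auto
    define b where "b = c * sqrt (norm z * norm x)"
    have T: "p \<in> T" "q \<in> T"
      using p q by (auto simp: defect_iff)
    \<comment> \<open>For \<open>e\<close> in the range of \<open>\<Gamma>\<^sub>0\<close> there is
      a defect element \<open>g\<close> at \<open>cnj \<mu>\<close>. In Green's identity for
      \<open>p - q\<close> and \<open>g\<close> the terms in \<open>fst p\<close> cancel, leaving
      \<open>(\<mu> - \<nu>) * cinner (fst q) (fst g)\<close>.\<close>
    have test: "cmod (cinner (y - z) e) \<le> b * norm e" if e: "e \<in> \<Gamma>\<^sub>0 ` T" for e
    proof -
      have \<mu>': "Im (cnj \<mu>) \<noteq> 0"
        using \<mu> by simp
      obtain g where g: "g \<in> defect_rel T (cnj \<mu>)" "\<Gamma>\<^sub>0 g = e"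
        using ex_defect[OF \<mu>' e] .
      obtain h where h: "h \<in> defect_rel T \<nu>" "\<Gamma>\<^sub>0 h = e"
        using ex_defect[OF \<nu> e] .
      have "(e, \<Gamma>\<^sub>1 h) \<in> weyl T \<Gamma>\<^sub>0 \<Gamma>\<^sub>1 \<nu>"
        using h weyl_iff[OF \<nu>] by auto
      then have "norm (\<Gamma>\<^sub>1 h) * norm e \<le> C * norm e * norm e"
        by (intro mult_right_mono bound) auto
      then have "sqrt (norm (\<Gamma>\<^sub>1 h) * norm e) \<le> sqrt (C * norm e * norm e)"
        by (rule real_sqrt_le_mono)
      then have "sqrt (norm (\<Gamma>\<^sub>1 h) * norm e) \<le> sqrt C * norm e"
        by (simp add: real_sqrt_mult mult.assoc)
      with gam[OF h(1)] a have hb: "norm (fst h) \<le> a * (sqrt C * norm e)"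
        unfolding h(2) by (meson mult_left_mono order_trans)
      have "norm (fst g) \<le> m * norm (fst h)"
        using defect_norm_le[OF \<mu>' g(1) h(1)] g h by (simp add: m_def)
      also have "\<dots> \<le> m * (a * (sqrt C * norm e))"
        by (intro mult_left_mono hb m)
      finally have gb: "norm (fst g) \<le> m * (a * (sqrt C * norm e))" .
      have "g \<in> T" "p - q \<in> T"
        using g T cvec.subspace_diff[OF subT] by (auto simp: defect_iff)
      from green[OF this(2,1)]
      have "cinner (y - z) e = (\<mu> - \<nu>) * cinner (fst q) (fst g)"
        using p q g T
        by (simp add: boundary_diff defect_iff cinner_diff_left cinner_scaleC_left cinner_scaleC_right algebra_simps)
      then have "cmod (cinner (y - z) e) \<le> cmod (\<mu> - \<nu>) * (norm (fst q) * norm (fst g))"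
        using cinner_Cauchy_Schwarz[of "fst q" "fst g"] by (simp add: norm_mult mult_left_mono)
      also have "\<dots> \<le> cmod (\<mu> - \<nu>) * ((a * sqrt (norm z * norm x)) * (m * (a * (sqrt C * norm e))))"
        using gam[OF q(1)] gb a unfolding q by (intro mult_left_mono mult_mono) auto
      also have "\<dots> = b * norm e"
        by (simp add: b_def c_def)
      finally show ?thesis .
    qed
    \<comment> \<open>Density extends the test to every \<open>e\<close>, in particular to
      \<open>y - z\<close>.\<close>
    have "closed {e. cmod (cinner (y - z) e) \<le> b * norm e}"
      by (intro closed_Collect_le continuous_intros)
    then have "closure (\<Gamma>\<^sub>0 ` T) \<subseteq> {e. cmod (cinner (y - z) e) \<le> b * norm e}"
      using test by (intro closure_minimal) auto
    then have "cmod (cinner (y - z) (y - z)) \<le> b * norm (y - z)"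
      using dense_range0 by auto
    then have "norm (y - z) * norm (y - z) \<le> b * norm (y - z)"
      by (simp add: cinner_self power2_eq_square norm_mult)
    moreover have "b \<ge> 0"
      using c by (simp add: b_def)
    ultimately have "norm (y - z) \<le> b"
      by (cases "y = z") (auto simp: mult_le_cancel_right)
    then show ?thesis
      by (simp add: b_def)
  qed
  with c show ?thesis by (rule that)
qed

text \<open>Compactness is carried from \<open>\<nu>\<close> to \<open>\<mu>\<close>: the difference
  bound shows first that the closure at \<open>\<mu>\<close> is a bounded operator, then that it is
  dominated by the compact one at \<open>\<nu>\<close>.\<close>

lemma weyl_compact:
  assumes \<mu>: "Im \<mu> \<noteq> 0" and \<nu>: "Im \<nu> \<noteq> 0" and cpt: "compact_operator (closure (weyl T \<Gamma>\<^sub>0 \<Gamma>\<^sub>1 \<nu>))"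
  obtains N where "bounded_linear N" "compact_map N"
    "\<And>x y. (x, y) \<in> closure (weyl T \<Gamma>\<^sub>0 \<Gamma>\<^sub>1 \<mu>) \<longleftrightarrow> y = N x"
proof -
  let ?W = "weyl T \<Gamma>\<^sub>0 \<Gamma>\<^sub>1"
  obtain C where C: "C \<ge> 0" "\<And>x y. (x, y) \<in> closure (?W \<nu>) \<Longrightarrow> norm y \<le> C * norm x"
    using compact_operator_bounded[OF cpt] by blast
  have bd0: "norm y \<le> C * norm x" if "(x, y) \<in> ?W \<nu>" for x y
    using C(2) closure_subset that by blast
  obtain N0 where N0: "bounded_linear N0" "\<And>x y. (x, y) \<in> closure (?W \<nu>) \<longleftrightarrow> y = N0 x"
    using closure_bounded_relation[OF subspace_weyl[OF \<nu>] _ bd0] dense_range0 by (metis Domain_weyl)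
  have cN0: "compact_map N0"
    using compact_operator_compact_map[OF cpt N0(1)] N0(2) by simp
  have bN0: "norm (N0 x) \<le> C * norm x" for x
    using C(2)[of x "N0 x"] N0(2) by simp
  obtain c where c: "c \<ge> 0" "\<And>x y z. (x, y) \<in> ?W \<mu> \<Longrightarrow> (x, z) \<in> ?W \<nu> \<Longrightarrow>
      norm (y - z) \<le> c * sqrt (norm z * norm x)"
    using weyl_difference_bound[OF \<mu> \<nu> C(1) bd0] by blast
  have est: "norm (y - N0 x) \<le> c * sqrt (norm (N0 x) * norm x)" if xy: "(x, y) \<in> ?W \<mu>" for x y
  proof -
    obtain z where z: "(x, z) \<in> ?W \<nu>"
      using xy Domain_weyl by blast
    then have "z = N0 x"
      using N0(2) closure_subset by blast
    with c(2)[OF xy z] show ?thesis by simp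
  qed
  have bd: "norm y \<le> (C + c * sqrt C) * norm x" if xy: "(x, y) \<in> ?W \<mu>" for x y
  proof -
    have "sqrt (norm (N0 x) * norm x) \<le> sqrt (C * norm x * norm x)"
      by (intro real_sqrt_le_mono mult_right_mono bN0) auto
    then have "c * sqrt (norm (N0 x) * norm x) \<le> c * (sqrt C * norm x)"
      using c(1) by (intro mult_left_mono) (auto simp: real_sqrt_mult mult.assoc)
    with est[OF xy] bN0[of x] norm_triangle_ineq[of "y - N0 x" "N0 x"] show ?thesis
      by (simp add: algebra_simps)
  qed
  obtain N where N: "bounded_linear N" "\<And>x y. (x, y) \<in> closure (?W \<mu>) \<longleftrightarrow> y = N x"
    using closure_bounded_relation[OF subspace_weyl[OF \<mu>] _ bd] dense_range0 by (metis Domain_weyl)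
  let ?P = "{p. norm (snd p - N0 (fst p)) \<le> c * sqrt (norm (N0 (fst p)) * norm (fst p))}"
  have "closed ?P"
    by (intro closed_Collect_le continuous_intros bounded_linear.continuous_on[OF N0(1)])
  then have "closure (?W \<mu>) \<subseteq> ?P"
    using est by (intro closure_minimal) auto
  then have "norm (N x - N0 x) \<le> c * sqrt (norm (N0 x) * norm x)" for x
    using N(2)[of x "N x"] by auto
  then have "norm (N x) \<le> norm (N0 x) + c * sqrt (norm (N0 x) * norm x)" for x
    using norm_triangle_ineq[of "N x - N0 x" "N0 x"] by (smt (verit) diff_add_cancel)
  then have "compact_map N"
    using N(1) N0(1) cN0 c(1) by (intro compact_map_dominated[of N N0 c]) (auto simp: bounded_linear.linear)
  with N show ?thesis
    using that by blast
qed

lemma extension_range: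
  assumes ker1: "self_adjoint {f \<in> T. \<Gamma>\<^sub>1 f = 0}"
    and \<Theta>: "self_adjoint \<Theta>" "0 \<notin> ess_spectrum \<Theta>"
    and \<mu>: "Im \<mu> \<noteq> 0" and \<nu>: "Im \<nu> \<noteq> 0" and cpt: "compact_operator (closure (weyl T \<Gamma>\<^sub>0 \<Gamma>\<^sub>1 \<nu>))"
    and pre: "\<Theta>\<inverse> `` Range (closure (weyl T \<Gamma>\<^sub>0 \<Gamma>\<^sub>1 \<mu>)) \<subseteq> \<Gamma>\<^sub>0 ` T"
  shows "\<exists>f f'. (f, f') \<in> extension_rel T \<Gamma>\<^sub>0 \<Gamma>\<^sub>1 \<Theta> \<and> f' - \<mu> *\<^sub>C f = h"
proof -
  obtain N where N: "bounded_linear N" "compact_map N"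
    and N_iff: "\<And>x y. (x, y) \<in> closure (weyl T \<Gamma>\<^sub>0 \<Gamma>\<^sub>1 \<mu>) \<longleftrightarrow> y = N x"
    using weyl_compact[OF \<mu> \<nu> cpt] by blast
  interpret N: bounded_linear N by (rule N)
  obtain F B where F: "bounded_linear F" "compact_map F" and B: "bounded_linear B"
    and B_iff: "\<And>z x. x = B z \<longleftrightarrow> (x, z - F x) \<in> \<Theta>"
    using self_adjoint_invertible_modulo_compact[OF \<Theta>] by blast
  interpret B: bounded_linear B by (rule B)
  have weyl_N: "\<Gamma>\<^sub>1 p = N (\<Gamma>\<^sub>0 p)" if "p \<in> defect_rel T \<mu>" for p
    using that weyl_iff[OF \<mu>] N_iff closure_subset by blast
  \<comment> \<open>Here the range inclusion turns a solution in the whole boundary space into the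
    boundary value of a defect element.\<close>
  have ex: "\<exists>p\<in>defect_rel T \<mu>. \<Gamma>\<^sub>0 p = x" if "(x, N z) \<in> \<Theta>" for x z
  proof -
    have "(z, N z) \<in> closure (weyl T \<Gamma>\<^sub>0 \<Gamma>\<^sub>1 \<mu>)"
      by (simp add: N_iff)
    then have "x \<in> \<Gamma>\<^sub>0 ` T"
      using that pre by blast
    then show ?thesis
      using ex_defect[OF \<mu>] by metis
  qed
  obtain f0 where f0: "f0 \<in> T" "\<Gamma>\<^sub>0 f0 = 0" "snd f0 - \<mu> *\<^sub>C fst f0 = h"
    using self_adjoint_range_shift[OF self_adjoint_ker0 \<mu>, of h] by blast
  obtain f1 where f1: "f1 \<in> T" "\<Gamma>\<^sub>1 f1 = 0" "snd f1 - \<mu> *\<^sub>C fst f1 = h"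
    using self_adjoint_range_shift[OF ker1 \<mu>, of h] by blast
  have "snd (f0 - f1) = \<mu> *\<^sub>C fst (f0 - f1)"
    using f0(3) f1(3) by (simp add: cvec.scale_right_diff_distrib algebra_simps)
  then have "f0 - f1 \<in> defect_rel T \<mu>"
    using cvec.subspace_diff[OF subT f0(1) f1(1)] by (simp add: defect_iff)
  from weyl_N[OF this] have \<psi>: "\<Gamma>\<^sub>1 f0 = N (\<Gamma>\<^sub>0 (f0 - f1))"
    using f0 f1 by (simp add: boundary_diff)
  \<comment> \<open>Adding \<open>F x\<close> to the second component of
    \<open>(x, \<Gamma>\<^sub>1 f0 + N x) \<in> \<Theta>\<close> and applying \<open>B\<close> gives
    the equation below.\<close>
  define K where "K x = B (N x + F x)" for x
  have "\<exists>x. x - K x = B (\<Gamma>\<^sub>1 f0)"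
  proof (rule Fredholm_alternative_surj)
    show "bounded_linear K"
      unfolding K_def by (intro bounded_linear_compose[OF B] bounded_linear_add N F)
    show "compact_map K"
      unfolding K_def
      by (intro compact_map_compose[where B = B] compact_map_add N F)
        (use linear_continuous_at[OF B] in auto)
  next
    fix x assume "K x = x"
    then have x\<Theta>: "(x, N x) \<in> \<Theta>"
      using B_iff[of x "N x + F x"] by (simp add: K_def)
    then obtain p where p: "p \<in> defect_rel T \<mu>" "\<Gamma>\<^sub>0 p = x"
      using ex by blast
    have "cinner (N x) x = cnj (cinner (N x) x)"
      using self_adjointD[OF \<Theta>(1) x\<Theta> x\<Theta>] cinner_commute[of x "N x"] by simp
    then have "Im (cinner (N x) x) = 0"
      by (simp add: complex_eq_iff)
    then have "fst p = 0"
      using Im_weyl[OF p(1)] weyl_N[OF p(1)] p(2) \<mu> by simp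
    with p(1) have "p = 0"
      by (simp add: defect_iff prod_eq_iff)
    with p(2) show "x = 0"
      by (simp add: boundary_zero)
  qed
  then obtain x where "x - K x = B (\<Gamma>\<^sub>1 f0)" by blast
  then have "x = B (\<Gamma>\<^sub>1 f0 + N x + F x)"
    by (simp add: K_def B.add algebra_simps)
  then have x: "(x, \<Gamma>\<^sub>1 f0 + N x) \<in> \<Theta>"
    using B_iff by simp
  \<comment> \<open>\<open>ex\<close> requires a second component in the range of \<open>N\<close>;
    \<open>\<Gamma>\<^sub>1 f0\<close> was obtained as such a value by means of
    \<open>f1\<close>.\<close>
  then obtain p where p: "p \<in> defect_rel T \<mu>" "\<Gamma>\<^sub>0 p = x"
    using ex[of x "\<Gamma>\<^sub>0 (f0 - f1) + x"] by (auto simp: \<psi> N.add)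
  have pT: "p \<in> T" "snd p = \<mu> *\<^sub>C fst p"
    using p(1) by (simp_all add: defect_iff)
  have "f0 + p \<in> extension_rel T \<Gamma>\<^sub>0 \<Gamma>\<^sub>1 \<Theta>"
    using x p f0 pT weyl_N[OF p(1)] cvec.subspace_add[OF subT f0(1) pT(1)]
    by (simp add: extension_rel_def boundary_add)
  moreover have "snd (f0 + p) - \<mu> *\<^sub>C fst (f0 + p) = h"
    using f0(3) pT(2) by (simp add: scaleC_add_right)
  ultimately show ?thesis
    by (cases "f0 + p") (auto simp del: fst_add snd_add)
qed

section \<open>Linearity and symmetry of the extension\<close>

lemma subspace_extension:
  assumes "cvec.subspace \<Theta>"
  shows "cvec.subspace (extension_rel T \<Gamma>\<^sub>0 \<Gamma>\<^sub>1 \<Theta>)"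
  unfolding cvec.subspace_def
proof (intro conjI ballI allI)
  show "0 \<in> extension_rel T \<Gamma>\<^sub>0 \<Gamma>\<^sub>1 \<Theta>"
    by (simp add: extension_rel_def boundary_zero cvec.subspace_0[OF subT] rel_zero[OF assms])
next
  fix p q assume "p \<in> extension_rel T \<Gamma>\<^sub>0 \<Gamma>\<^sub>1 \<Theta>" "q \<in> extension_rel T \<Gamma>\<^sub>0 \<Gamma>\<^sub>1 \<Theta>"
  then show "p + q \<in> extension_rel T \<Gamma>\<^sub>0 \<Gamma>\<^sub>1 \<Theta>"
    by (simp add: extension_rel_def boundary_add cvec.subspace_add[OF subT] rel_add[OF assms])
next
  fix c p assume "p \<in> extension_rel T \<Gamma>\<^sub>0 \<Gamma>\<^sub>1 \<Theta>"
  then show "c *\<^sub>C p \<in> extension_rel T \<Gamma>\<^sub>0 \<Gamma>\<^sub>1 \<Theta>"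
    by (simp add: extension_rel_def boundary_scale cvec.subspace_scale[OF subT] rel_scale[OF assms])
qed

text \<open>The boundary terms of Green's identity cancel because \<open>\<Theta>\<close> is
  symmetric.\<close>

lemma symmetric_extension:
  assumes "self_adjoint \<Theta>"
  shows "symmetric_rel (extension_rel T \<Gamma>\<^sub>0 \<Gamma>\<^sub>1 \<Theta>)"
  unfolding symmetric_rel_def
proof (rule subrelI)
  fix g g' assume g: "(g, g') \<in> extension_rel T \<Gamma>\<^sub>0 \<Gamma>\<^sub>1 \<Theta>"
  have "cinner f' g = cinner f g'" if f: "(f, f') \<in> extension_rel T \<Gamma>\<^sub>0 \<Gamma>\<^sub>1 \<Theta>" for f f'
    using f g green[of "(f, f')" "(g, g')"]
      self_adjointD[OF assms, of "\<Gamma>\<^sub>0 (f, f')" "\<Gamma>\<^sub>1 (f, f')" "\<Gamma>\<^sub>0 (g, g')" "\<Gamma>\<^sub>1 (g, g')"]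
    by (simp add: extension_rel_def)
  then show "(g, g') \<in> adjoint_rel (extension_rel T \<Gamma>\<^sub>0 \<Gamma>\<^sub>1 \<Theta>)"
    by (simp add: adjoint_rel_iff)
qed

end

theorem theorem3p13:
  fixes A T :: "('h::complex_hilbert_space \<times> 'h) set"
    and \<Gamma>\<^sub>0 \<Gamma>\<^sub>1 :: "'h \<times> 'h \<Rightarrow> 'g::complex_hilbert_space"
    and \<Theta> :: "('g \<times> 'g) set"
    and \<mu>\<^sub>0 \<mu>\<^sub>p \<mu>\<^sub>m :: complex
  assumes "linear_relation A" and "closed A" and "symmetric_rel A"
    and "quasi_boundary_triple A T \<Gamma>\<^sub>0 \<Gamma>\<^sub>1"
    and "self_adjoint {f \<in> T. \<Gamma>\<^sub>1 f = 0}"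
    and "\<mu>\<^sub>0 \<notin> \<real>" and "compact_operator (closure (weyl T \<Gamma>\<^sub>0 \<Gamma>\<^sub>1 \<mu>\<^sub>0))"
    and "self_adjoint \<Theta>"
    and "Im \<mu>\<^sub>p > 0" and "Im \<mu>\<^sub>m < 0"
  shows "(0 \<notin> ess_spectrum \<Theta> \<and>
          \<Theta>\<inverse> `` Range (closure (weyl T \<Gamma>\<^sub>0 \<Gamma>\<^sub>1 \<mu>\<^sub>p)) \<subseteq> \<Gamma>\<^sub>0 ` T \<and>
          \<Theta>\<inverse> `` Range (closure (weyl T \<Gamma>\<^sub>0 \<Gamma>\<^sub>1 \<mu>\<^sub>m)) \<subseteq> \<Gamma>\<^sub>0 ` T
            \<longrightarrow> self_adjoint (extension_rel T \<Gamma>\<^sub>0 \<Gamma>\<^sub>1 \<Theta>)) \<and>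
         (Domain \<Theta> \<subseteq> \<Gamma>\<^sub>0 ` T
            \<longrightarrow> \<Theta>\<inverse> `` Range (closure (weyl T \<Gamma>\<^sub>0 \<Gamma>\<^sub>1 \<mu>\<^sub>p)) \<subseteq> \<Gamma>\<^sub>0 ` T \<and>
                \<Theta>\<inverse> `` Range (closure (weyl T \<Gamma>\<^sub>0 \<Gamma>\<^sub>1 \<mu>\<^sub>m)) \<subseteq> \<Gamma>\<^sub>0 ` T)"
proof (intro conjI impI)
  interpret quasi_triple A T \<Gamma>\<^sub>0 \<Gamma>\<^sub>1
    using assms(4) by unfold_locales
  have \<mu>\<^sub>0: "Im \<mu>\<^sub>0 \<noteq> 0"
    using assms(6) by (simp add: complex_is_Real_iff)
  assume *: "0 \<notin> ess_spectrum \<Theta> \<and>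
    \<Theta>\<inverse> `` Range (closure (weyl T \<Gamma>\<^sub>0 \<Gamma>\<^sub>1 \<mu>\<^sub>p)) \<subseteq> \<Gamma>\<^sub>0 ` T \<and>
    \<Theta>\<inverse> `` Range (closure (weyl T \<Gamma>\<^sub>0 \<Gamma>\<^sub>1 \<mu>\<^sub>m)) \<subseteq> \<Gamma>\<^sub>0 ` T"
  show "self_adjoint (extension_rel T \<Gamma>\<^sub>0 \<Gamma>\<^sub>1 \<Theta>)"
  proof (rule self_adjoint_if_symmetric_surj[OF _ _ assms(9,10)])
    show "cvec.subspace (extension_rel T \<Gamma>\<^sub>0 \<Gamma>\<^sub>1 \<Theta>)"
      by (intro subspace_extension self_adjoint_csubspace assms(8))
    show "symmetric_rel (extension_rel T \<Gamma>\<^sub>0 \<Gamma>\<^sub>1 \<Theta>)"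
      by (rule symmetric_extension[OF assms(8)])
  next
    fix h
    have "Im \<mu>\<^sub>p \<noteq> 0" "Im \<mu>\<^sub>m \<noteq> 0"
      using assms(9,10) by simp_all
    with * show
      "\<exists>f f'. (f, f') \<in> extension_rel T \<Gamma>\<^sub>0 \<Gamma>\<^sub>1 \<Theta> \<and> f' - \<mu>\<^sub>p *\<^sub>C f = h"
      "\<exists>f f'. (f, f') \<in> extension_rel T \<Gamma>\<^sub>0 \<Gamma>\<^sub>1 \<Theta> \<and> f' - \<mu>\<^sub>m *\<^sub>C f = h"
      using extension_range[OF assms(5,8) _ _ \<mu>\<^sub>0 assms(7)] by simp_all
  qed
\<comment> \<open>A preimage under \<open>\<Theta>\<close> always lies in its domain, which settles
  the last claim.\<close>
qed blast+

end
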